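(* For every positive integer $u\equiv 1,3\pmod 6$ there exist a GLS*$(1,3;2,(3,\{3\},\{3\},\{5\}),3u+2)$ and a GLS$(1,3;2,(3,\{3\},\{3\},\{3\}),3u+2)$.
   Context: An S$(\lambda;2,K,v)$ is a pair $(X,\mathcal{B})$, $|X|=v$, $\mathcal{B}$ a multiset of subsets (blocks) of $X$ with sizes in $K$, each 2-subset of $X$ in exactly $\lambda$ blocks. An S$(3,K,v)$ is a pair $(X,\mathcal{B})$ with $\mathcal{B}$ a set of subsets of sizes in $K$, each 3-subset in exactly one block. An LS$(1,\lambda;2,(3,K),v)$ is a collection $(X,\mathcal{B}_r)_{r\in R}$ of S$(\lambda;2,K,v)$ on a common $X$ such that $(X,\bigcup_r\mathcal{B}_r)$ (ordinary union) is an S$(3,K,v)$ and each block $B$ of that union occurs exactly $|B|-2$ times in the multiset $\{B: B\in\mathcal{B}_r, r\in R\}$; it is an LS* if moreover each $B\in\mathcal{B}_r$ with $|B|\ge4$ occurs exactly $\lambda$ times in $\mathcal{B}_r$. An S$(\lambda;2,(K_0,K_1,K_2),v)$ is a quadruple $(S,\infty_1,\infty_2,\mathcal{B})$ with $|S|=v-2$, $\infty_1\ne\infty_2$, $\infty_1,\infty_2\notin S$, such that $(S\cup\{\infty_1,\infty_2\},\mathcal{B})$ is an S$(\lambda;2,K_0\cup K_1\cup K_2,v)$ and $|B|\in K_i$ for each block $B$ with $|B\cap\{\infty_1,\infty_2\}|=i$. An LS$(1,\lambda;2,(3,K_0,K_1,K_2),v)$ is a collection $(S,\infty_1,\infty_2,\mathcal{B}_r)_{r\in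 R}$ of such designs with $(S\cup\{\infty_1,\infty_2\},\mathcal{B}_r)_{r\in R}$ an LS$(1,\lambda;2,(3,K_0\cup K_1\cup K_2),v)$ (LS* analogously). A good design GS$(\lambda;2,(K_0,\{3\},K_2),v)$ is a 5-tuple $(S,\infty_1,\infty_2,\mathcal{B},D)$ where $(S,\infty_1,\infty_2,\mathcal{B})$ is an S$(\lambda;2,(K_0,\{3\},K_2),v)$ and $D$ is an Eulerian digraph on $S$ (every vertex has equal in-degree and out-degree) whose underlying undirected graph has edge set $\{\{x,y\}: x,y\in S, \{\infty_i,x,y\}\in\mathcal{B}, i\in\{1,2\}\}$. A GLS$(1,\lambda;2,(3,K_0,\{3\},K_2),v)$ is a collection $(S,\infty_1,\infty_2,\mathcal{B}_r,D_r)_{r\in R}$ of such GS where $(S,\infty_1,\infty_2,\mathcal{B}_r)_{r\in R}$ is an LS$(1,\lambda;2,(3,K_0,\{3\},K_2),v)$ and every ordered pair $(x,y)$ of distinct elements of $S$ not contained in any block $B$ with $\{\infty_1,\infty_2\}\subset B$ is an arc of exactly one $D_r$. A GLS* is a GLS whose underlying LS is an LS*. *)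

theory Defs
  imports "HOL-Library.Multiset" "Graph_Theory.Pair_Digraph"
begin

text \<open>
  Every design is a predicate on its data, with the order \<open>v\<close> as a separate argument:
  \<open>pair_design\<close> is \<open>S(lam; 2, K, v)\<close>, \<open>triple_design\<close> is \<open>S(3, K, v)\<close>,
  \<open>large_set\<close> is \<open>LS(1, lam; 2, (3, K), v)\<close>, \<open>pointed_design\<close> is
  \<open>S(lam; 2, (K0, K1, K2), v)\<close>, \<open>pointed_large_set\<close> is
  \<open>LS(1, lam; 2, (3, K0, K1, K2), v)\<close>, \<open>good_design\<close> is \<open>GS(lam; 2, (K0, {3}, K2), v)\<close> and
  \<open>good_large_set\<close> is \<open>GLS(1, lam; 2, (3, K0, {3}, K2), v)\<close>.
\<close>

definition pair_design ::
  "nat \<Rightarrow> nat set \<Rightarrow> nat \<Rightarrow> 'a set \<Rightarrow> 'a set multiset \<Rightarrow> bool" where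
  "pair_design lam K v X \<B> \<longleftrightarrow>
     finite X \<and> card X = v \<and>
     (\<forall>B\<in>#\<B>. B \<subseteq> X \<and> card B \<in> K) \<and>
     (\<forall>P. P \<subseteq> X \<and> card P = 2 \<longrightarrow> size {#B \<in># \<B>. P \<subseteq> B#} = lam)"

definition triple_design :: "nat set \<Rightarrow> nat \<Rightarrow> 'a set \<Rightarrow> 'a set set \<Rightarrow> bool" where
  "triple_design K v X \<A> \<longleftrightarrow>
     finite X \<and> card X = v \<and>
     (\<forall>B\<in>\<A>. B \<subseteq> X \<and> card B \<in> K) \<and>
     (\<forall>T. T \<subseteq> X \<and> card T = 3 \<longrightarrow> (\<exists>!B. B \<in> \<A> \<and> T \<subseteq> B))"

text \<open>
  The truncated subtraction in \<open>card B - 2\<close> is harmless: a block of size at most 2 would have to occur 0 times, which the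
  membership in the union excludes.
\<close>

definition large_set ::
  "nat \<Rightarrow> nat set \<Rightarrow> nat \<Rightarrow> 'a set \<Rightarrow> 'i set \<Rightarrow> ('i \<Rightarrow> 'a set multiset) \<Rightarrow> bool" where
  "large_set lam K v X R \<B> \<longleftrightarrow>
     finite R \<and>
     (\<forall>r\<in>R. pair_design lam K v X (\<B> r)) \<and>
     triple_design K v X (\<Union>r\<in>R. set_mset (\<B> r)) \<and>
     (\<forall>B\<in>(\<Union>r\<in>R. set_mset (\<B> r)). count (\<Sum>r\<in>R. \<B> r) B = card B - 2)"

definition large_set_star ::
  "nat \<Rightarrow> nat set \<Rightarrow> nat \<Rightarrow> 'a set \<Rightarrow> 'i set \<Rightarrow> ('i \<Rightarrow> 'a set multiset) \<Rightarrow> bool" where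
  "large_set_star lam K v X R \<B> \<longleftrightarrow>
     large_set lam K v X R \<B> \<and>
     (\<forall>r\<in>R. \<forall>B\<in>#\<B> r. 4 \<le> card B \<longrightarrow> count (\<B> r) B = lam)"

definition pointed_design ::
  "nat \<Rightarrow> nat set \<Rightarrow> nat set \<Rightarrow> nat set \<Rightarrow> nat \<Rightarrow>
   'a set \<Rightarrow> 'a \<Rightarrow> 'a \<Rightarrow> 'a set multiset \<Rightarrow> bool" where
  "pointed_design lam K0 K1 K2 v S inf1 inf2 \<B> \<longleftrightarrow>
     finite S \<and> card S + 2 = v \<and> inf1 \<noteq> inf2 \<and> inf1 \<notin> S \<and> inf2 \<notin> S \<and>
     pair_design lam (K0 \<union> K1 \<union> K2) v (S \<union> {inf1, inf2}) \<B> \<and>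
     (\<forall>B\<in>#\<B>. (card (B \<inter> {inf1, inf2}) = 0 \<longrightarrow> card B \<in> K0) \<and>
               (card (B \<inter> {inf1, inf2}) = 1 \<longrightarrow> card B \<in> K1) \<and>
               (card (B \<inter> {inf1, inf2}) = 2 \<longrightarrow> card B \<in> K2))"

definition pointed_large_set ::
  "nat \<Rightarrow> nat set \<Rightarrow> nat set \<Rightarrow> nat set \<Rightarrow> nat \<Rightarrow>
   'a set \<Rightarrow> 'a \<Rightarrow> 'a \<Rightarrow> 'i set \<Rightarrow> ('i \<Rightarrow> 'a set multiset) \<Rightarrow> bool" where
  "pointed_large_set lam K0 K1 K2 v S inf1 inf2 R \<B> \<longleftrightarrow>
     (\<forall>r\<in>R. pointed_design lam K0 K1 K2 v S inf1 inf2 (\<B> r)) \<and>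
     large_set lam (K0 \<union> K1 \<union> K2) v (S \<union> {inf1, inf2}) R \<B>"

definition pointed_large_set_star ::
  "nat \<Rightarrow> nat set \<Rightarrow> nat set \<Rightarrow> nat set \<Rightarrow> nat \<Rightarrow>
   'a set \<Rightarrow> 'a \<Rightarrow> 'a \<Rightarrow> 'i set \<Rightarrow> ('i \<Rightarrow> 'a set multiset) \<Rightarrow> bool" where
  "pointed_large_set_star lam K0 K1 K2 v S inf1 inf2 R \<B> \<longleftrightarrow>
     (\<forall>r\<in>R. pointed_design lam K0 K1 K2 v S inf1 inf2 (\<B> r)) \<and>
     large_set_star lam (K0 \<union> K1 \<union> K2) v (S \<union> {inf1, inf2}) R \<B>"

text \<open>
  Digraphs have neither loops nor parallel arcs, but may contain both \<open>(x, y)\<close> and \<open>(y, x)\<close>.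
  Eulerian means balanced at every vertex; connectedness is not required.
\<close>

definition eulerian_digraph :: "'a pair_pre_digraph \<Rightarrow> bool" where
  "eulerian_digraph D \<longleftrightarrow>
     pair_digraph D \<and>
     (\<forall>x\<in>pverts D. in_degree (with_proj D) x = out_degree (with_proj D) x)"

definition underlying_edges :: "'a pair_pre_digraph \<Rightarrow> 'a set set" where
  "underlying_edges D = {{x, y} | x y. (x, y) \<in> parcs D}"

definition good_design ::
  "nat \<Rightarrow> nat set \<Rightarrow> nat set \<Rightarrow> nat \<Rightarrow>
   'a set \<Rightarrow> 'a \<Rightarrow> 'a \<Rightarrow> 'a set multiset \<Rightarrow> 'a pair_pre_digraph \<Rightarrow> bool" where
  "good_design lam K0 K2 v S inf1 inf2 \<B> D \<longleftrightarrow>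
     pointed_design lam K0 {3} K2 v S inf1 inf2 \<B> \<and>
     eulerian_digraph D \<and> pverts D = S \<and>
     underlying_edges D =
       {{x, y} | x y. x \<in> S \<and> y \<in> S \<and> (\<exists>i\<in>{inf1, inf2}. {i, x, y} \<in># \<B>)}"

definition good_large_set ::
  "nat \<Rightarrow> nat set \<Rightarrow> nat set \<Rightarrow> nat \<Rightarrow>
   'a set \<Rightarrow> 'a \<Rightarrow> 'a \<Rightarrow> 'i set \<Rightarrow> ('i \<Rightarrow> 'a set multiset) \<Rightarrow> ('i \<Rightarrow> 'a pair_pre_digraph) \<Rightarrow> bool"
  where
  "good_large_set lam K0 K2 v S inf1 inf2 R \<B> D \<longleftrightarrow>
     (\<forall>r\<in>R. good_design lam K0 K2 v S inf1 inf2 (\<B> r) (D r)) \<and>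
     pointed_large_set lam K0 {3} K2 v S inf1 inf2 R \<B> \<and>
     (\<forall>x\<in>S. \<forall>y\<in>S. x \<noteq> y \<and>
        \<not> (\<exists>B\<in>(\<Union>r\<in>R. set_mset (\<B> r)). {inf1, inf2} \<subset> B \<and> {x, y} \<subseteq> B) \<longrightarrow>
        (\<exists>!r. r \<in> R \<and> (x, y) \<in> parcs (D r)))"

definition good_large_set_star ::
  "nat \<Rightarrow> nat set \<Rightarrow> nat set \<Rightarrow> nat \<Rightarrow>
   'a set \<Rightarrow> 'a \<Rightarrow> 'a \<Rightarrow> 'i set \<Rightarrow> ('i \<Rightarrow> 'a set multiset) \<Rightarrow> ('i \<Rightarrow> 'a pair_pre_digraph) \<Rightarrow> bool"
  where
  "good_large_set_star lam K0 K2 v S inf1 inf2 R \<B> D \<longleftrightarrow>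
     good_large_set lam K0 K2 v S inf1 inf2 R \<B> D \<and>
     pointed_large_set_star lam K0 {3} K2 v S inf1 inf2 R \<B>"

end

theory Submission
  imports Defs
begin

text \<open>
  Let \<open>\<star>\<close> be the Steiner quasigroup of a Steiner triple system on \<open>{0..<u}\<close>, and cut the \<open>3 * u\<close> finite
  points into groups \<open>{3 * a, 3 * a + 1, 3 * a + 2}\<close>. All triples on the \<open>3 * u + 2\<close> points are
  distributed over \<open>u\<close> classes: a triple \<open>{\<infinity>, x, y}\<close> with \<open>x\<close>, \<open>y\<close> in groups \<open>a\<close>, \<open>b\<close> goes to
  class \<open>a \<star> b\<close>; \<open>{\<infinity>\<^sub>1, \<infinity>\<^sub>2, x}\<close> goes to the group of \<open>x\<close>; a triple with groups \<open>a\<close>, \<open>a\<close>, \<open>b\<close>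
  goes to class \<open>b\<close>; and a triple \<open>{x, y, z}\<close> with distinct groups \<open>a < b < c\<close> goes to
  \<open>a \<star> (b \<star> c)\<close>, \<open>b \<star> (a \<star> c)\<close> or \<open>c \<star> (a \<star> b)\<close> according to \<open>(x + y + z) mod 3\<close>. For fixed \<open>x\<close>, \<open>y\<close>
  and class \<open>r\<close> each of these three equations determines the third group and then the third
  point, so every pair lies in exactly three triples of every class; the degenerate positions of
  \<open>r\<close> are compensated exactly by the other kinds of triples.

  Each class contains all ten triples of the 5-set formed by its group and the two infinite points.
  Replacing them by three copies of the 5-set turns the GLS into a GLS*. In both cases
  the two infinite points have the same link in a class, so the symmetric digraph on this link
  serves as the Eulerian digraph.
\<close>

section \<open>Steiner triple systems of order 1 and 3 modulo 6\<close>

text \<open>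
  The constructions of Bose (\<open>n\<close> odd) and Skolem (\<open>n\<close> even) are treated together: \<open>mid n\<close> is an
  idempotent commutative quasigroup for odd \<open>n\<close> and a half-idempotent one for even \<open>n\<close>; the points are
  \<open>Some (i, k)\<close> with \<open>i < n\<close>, \<open>k < 3\<close>, and an extra point \<open>None\<close> if \<open>n\<close> is even.
\<close>

definition steiner_op :: "'a set \<Rightarrow> ('a \<Rightarrow> 'a \<Rightarrow> 'a) \<Rightarrow> bool" where
  "steiner_op A f \<longleftrightarrow>
     (\<forall>x\<in>A. \<forall>y\<in>A. f x y \<in> A \<and> f x y = f y x \<and> f x (f x y) = y) \<and> (\<forall>x\<in>A. f x x = x)"

lemma steiner_op_transfer:
  assumes "steiner_op A f" and h: "bij_betw h A B"
  shows "\<exists>g. steiner_op B g"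
proof -
  define k where "k = inv_into A h"
  have k: "k b \<in> A" "h (k b) = b" if "b \<in> B" for b
    using that h by (auto simp: k_def bij_betw_def inv_into_into f_inv_into_f)
  have kh: "k (h a) = a" "h a \<in> B" if "a \<in> A" for a
    using that h by (auto simp: k_def bij_betw_def)
  have "steiner_op B (\<lambda>x y. h (f (k x) (k y)))"
    using assms(1) unfolding steiner_op_def by (simp add: k kh)
  then show ?thesis by blast
qed

section \<open>Halving modulo \<open>n\<close> and the midpoint quasigroup\<close>

definition halve :: "nat \<Rightarrow> nat \<Rightarrow> nat" where
  "halve n s = (if even s then s div 2 else (s + n) div 2)"

text \<open>The addition table of the integers modulo \<open>n\<close>, its entries renamed by the
  permutation \<open>halve n\<close> so as to make the diagonal idempotent or
  half-idempotent.\<close>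

definition mid :: "nat \<Rightarrow> nat \<Rightarrow> nat \<Rightarrow> nat" where
  "mid n i j = halve n ((i + j) mod n)"

lemma mid_commute: "mid n i j = mid n j i"
  by (simp add: mid_def add.commute)

lemma halve_less: "s < n \<Longrightarrow> halve n s < n"
  by (auto simp: halve_def)

lemma mid_less: "i < n \<Longrightarrow> mid n i j < n"
  by (simp add: mid_def halve_less)

lemma double_halve:
  "2 * halve n s = (if even s then s else if odd n then s + n else s + n - 1)"
proof (cases "even s")
  case False
  then obtain t where "s = 2 * t + 1" by (elim oddE)
  then show ?thesis by (cases "even n") (auto simp: halve_def elim!: evenE oddE)
qed (simp add: halve_def)

text \<open>By \<open>double_halve\<close>, twice the value is below \<open>n\<close> for even
  arguments and at least \<open>n\<close> for odd ones. So the value reveals the parity and then the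
  argument.\<close>

lemma inj_on_halve: "inj_on (halve n) {..<n}"
proof (rule inj_onI)
  fix s t assume "s \<in> {..<n}" "t \<in> {..<n}" "halve n s = halve n t"
  then have "2 * halve n s = 2 * halve n t" "s < n" "t < n" by auto
  then show "s = t" unfolding double_halve
    by (auto split: if_splits elim!: evenE oddE)
qed

lemma mid_cancel:
  assumes "i < n" "j < n" "k < n" and "mid n i j = mid n i k"
  shows "j = k"
proof -
  have "(i + j) mod n = (i + k) mod n"
    using assms inj_on_halve[of n] by (auto simp: mid_def inj_on_def)
  moreover have "(i + m) mod n = (if i + m < n then i + m else i + m - n)" if "m < n" for m
    using that assms(1) by (simp add: mod_if)
  ultimately show ?thesis using assms(1-3) by (auto split: if_splits)
qed

lemma mid_solve:
  assumes "i < n" "j < n"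
  shows "\<exists>m<n. mid n i m = j"
proof -
  have "inj_on (mid n i) {..<n}"
    using mid_cancel assms by (auto simp: inj_on_def)
  then have "mid n i ` {..<n} = {..<n}"
    by (intro endo_inj_surj) (use assms in \<open>auto intro: mid_less\<close>)
  then show ?thesis using assms(2) by (metis imageE lessThan_iff)
qed

text \<open>Left division for \<open>mid\<close>; for \<open>i\<close>, \<open>j\<close> below
  \<open>n\<close> the description is proper by \<open>mid_solve\<close> and
  \<open>mid_cancel\<close>.\<close>

definition quot :: "nat \<Rightarrow> nat \<Rightarrow> nat \<Rightarrow> nat" where
  "quot n i j = (THE m. m < n \<and> mid n i m = j)"

lemma quot_mid: "i < n \<Longrightarrow> j < n \<Longrightarrow> quot n i (mid n i j) = j"
  unfolding quot_def by (rule the_equality) (auto dest: mid_cancel)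

lemma quot: assumes "i < n" "j < n" shows "quot n i j < n" "mid n i (quot n i j) = j"
  using mid_solve[OF assms] quot_mid[OF assms(1)] by auto

text \<open>Without a wrap-around, halving undoes the doubling. After a wrap the residue is
  \<open>2 * i - n\<close>: odd for odd \<open>n\<close>, where halving adds \<open>n\<close> back,
  and even for even \<open>n\<close>.\<close>

lemma mid_diag:
  assumes "i < n"
  shows "mid n i i = (if even n \<and> n \<le> 2 * i then i - n div 2 else i)"
proof (cases "2 * i < n")
  case True
  then show ?thesis by (simp add: mid_def halve_def flip: mult_2)
next
  case False
  then have "(i + i) mod n = 2 * i - n"
    using assms by (simp add: mod_if mult_2)
  moreover have "(2 * i - n) div 2 = i - n div 2" if "even n" using that by auto
  ultimately show ?thesis using False assms by (simp add: mid_def halve_def)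
qed

section \<open>The Bose-Skolem product\<close>

definition up :: "nat \<Rightarrow> nat \<Rightarrow> nat \<Rightarrow> nat \<Rightarrow> (nat \<times> nat) option" where
  "up n i j k =
     (if j \<noteq> mid n i i then Some (quot n i j, k)
      else if i = j then Some (i, (k + 2) mod 3) else None)"

text \<open>Products with \<open>None\<close>. Its blocks join \<open>(i, k)\<close> with
  \<open>mid n i i \<noteq> i\<close> to \<open>(mid n i i, k + 1)\<close>; a fixed index is the
  other end of such a block, so its partner is \<open>n div 2\<close> higher and one level
  back.\<close>

fun inf_op :: "nat \<Rightarrow> nat \<times> nat \<Rightarrow> (nat \<times> nat) option" where
  "inf_op n (i, k) = (if mid n i i = i then Some (i + n div 2, (k + 2) mod 3)
                       else Some (mid n i i, (k + 1) mod 3))"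

text \<open>With levels modulo 3, the blocks are \<open>{(i, k), (j, k), (mid n i j, k + 1)}\<close>
  for \<open>i \<noteq> j\<close>, the three levels of each \<open>i\<close> with
  \<open>mid n i i = i\<close>, and \<open>{None, (i, k), (mid n i i, k + 1)}\<close> for the other
  \<open>i\<close>. The value \<open>up n i j k\<close> is the product of \<open>(i, k)\<close> and
  \<open>(j, k + 1)\<close>.\<close>

fun bs_op :: "nat \<Rightarrow> (nat \<times> nat) option \<Rightarrow> (nat \<times> nat) option \<Rightarrow> (nat \<times> nat) option" where
  "bs_op n None None = None"
| "bs_op n None (Some p) = inf_op n p"
| "bs_op n (Some p) None = inf_op n p"
| "bs_op n (Some (i, k)) (Some (j, l)) =
    (if k = l then Some (if i = j then (i, k) else (mid n i j, (k + 1) mod 3))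
     else if l = (k + 1) mod 3 then up n i j k else up n j i l)"

definition bs_points :: "nat \<Rightarrow> (nat \<times> nat) option set" where
  "bs_points n = Some ` ({..<n} \<times> {..<3}) \<union> (if even n then {None} else {})"

lemma None_bs_points: "None \<in> bs_points n \<longleftrightarrow> even n"
  and Some_bs_points: "Some (i, k) \<in> bs_points n \<longleftrightarrow> i < n \<and> k < 3"
  by (auto simp: bs_points_def)

lemma bs_points_cases:
  assumes "x \<in> bs_points n"
  obtains "x = None" "even n" | i k where "x = Some (i, k)" "i < n" "k < 3"
  using assms by (auto simp: bs_points_def split: if_splits)

text \<open>By \<open>mid_diag\<close>, only indices of the upper half are moved, and only for even
  \<open>n\<close>; they land in the lower half, whose indices are fixed.\<close>

lemma mid_drop:
  assumes "i < n" "mid n i i \<noteq> i"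
  shows "even n" "mid n i i + n div 2 = i" "mid n (mid n i i) (mid n i i) = mid n i i"
proof -
  have *: "even n" "n \<le> 2 * i" "mid n i i = i - n div 2"
    using assms(2) mid_diag[OF assms(1)] by (auto split: if_splits)
  have less: "i - n div 2 < n" "\<not> n \<le> 2 * (i - n div 2)" and "i - n div 2 + n div 2 = i"
    using *(1,2) assms(1) by auto
  with * show "even n" "mid n i i + n div 2 = i" "mid n (mid n i i) (mid n i i) = mid n i i"
    by (simp_all add: mid_diag[OF less(1)])
qed

text \<open>Inverse of \<open>mid_drop\<close>: fixed and moved indices are matched, which makes
  \<open>inf_op\<close> an involution.\<close>

lemma mid_lift:
  assumes "i < n" "mid n i i = i" "even n"
  shows "mid n (i + n div 2) (i + n div 2) = i" "i + n div 2 < n" "n \<noteq> 0"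
proof -
  have "2 * i < n"
  proof (rule ccontr)
    assume "\<not> 2 * i < n"
    then have "i - n div 2 = i" using mid_diag[OF assms(1)] assms(2,3) by simp
    with \<open>\<not> 2 * i < n\<close> assms(1,3) show False by presburger
  qed
  with assms(3) show less: "i + n div 2 < n" and "n \<noteq> 0" by presburger+
  from assms(3) have "n \<le> 2 * (i + n div 2)" by presburger
  with assms(3) show "mid n (i + n div 2) (i + n div 2) = i"
    by (simp add: mid_diag[OF less])
qed

lemma quot_ne: "i < n \<Longrightarrow> j < n \<Longrightarrow> j \<noteq> mid n i i \<Longrightarrow> quot n i j \<noteq> i"
  using quot(2)[of i n j] by auto

text \<open>By commutativity, \<open>j\<close> and \<open>quot n j i\<close> are the two factors of
  the product \<open>i\<close>, so each is the quotient of \<open>i\<close> by the other; they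
  differ because \<open>i\<close> is not the square of \<open>j\<close>.\<close>

lemma quot_quot:
  assumes "i < n" "j < n" "i \<noteq> mid n j j"
  shows "quot n (quot n j i) i = j" "mid n (quot n j i) (quot n j i) \<noteq> i"
proof -
  note q = quot[OF assms(2,1)]
  show "quot n (quot n j i) i = j"
    using quot_mid[OF q(1) assms(2)] by (simp add: mid_commute[of n _ j] q(2))
  show "mid n (quot n j i) (quot n j i) \<noteq> i"
  proof
    assume "mid n (quot n j i) (quot n j i) = i"
    then have "mid n (quot n j i) (quot n j i) = mid n (quot n j i) j"
      by (simp add: mid_commute[of n _ j] q(2))
    then have "quot n j i = j" using mid_cancel q(1) assms(2) by blast
    with q(2) assms(3) show False by simp
  qed
qed

lemma inf_op_closed: "i < n \<Longrightarrow> k < 3 \<Longrightarrow> even n \<Longrightarrow> inf_op n (i, k) \<in> bs_points n"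
  by (auto simp: Some_bs_points mid_less mid_lift)

lemma up_closed: "i < n \<Longrightarrow> j < n \<Longrightarrow> k < 3 \<Longrightarrow> up n i j k \<in> bs_points n"
  using mid_drop(1)[of i n] by (auto simp: up_def Some_bs_points None_bs_points quot)

lemma bs_op_closed:
  assumes "x \<in> bs_points n" "y \<in> bs_points n"
  shows "bs_op n x y \<in> bs_points n"
  using assms(1)
proof (cases rule: bs_points_cases)
  case x: 1
  from assms(2) show ?thesis
    by (cases rule: bs_points_cases) (simp_all add: x None_bs_points inf_op_closed del: inf_op.simps)
next
  case x: (2 i k)
  from assms(2) show ?thesis
    by (cases rule: bs_points_cases)
      (simp_all add: x Some_bs_points inf_op_closed up_closed mid_less del: inf_op.simps)
qed

lemma less_3_cases: "(k::nat) < 3 \<Longrightarrow> k = 0 \<or> k = 1 \<or> k = 2"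
  by auto

lemma bs_op_commute:
  assumes "x \<in> bs_points n" "y \<in> bs_points n"
  shows "bs_op n x y = bs_op n y x"
  using assms(1)
proof (cases rule: bs_points_cases)
  case x: 1
  show ?thesis by (cases y) (simp_all add: x)
next
  case x: (2 i k)
  from assms(2) show ?thesis
  proof (cases rule: bs_points_cases)
    case y: (2 j l)
    show ?thesis using less_3_cases[OF \<open>k < 3\<close>] less_3_cases[OF \<open>l < 3\<close>]
      by (elim disjE) (simp_all add: x y mid_commute)
  qed (simp add: x)
qed

lemma mod_3_shift:
  assumes "(k::nat) < 3"
  shows "(k + 1) mod 3 \<noteq> k" "(k + 2) mod 3 \<noteq> k" "k \<noteq> ((k + 1) mod 3 + 1) mod 3"
    "((k + 1) mod 3 + 2) mod 3 = k" "((k + 2) mod 3 + 1) mod 3 = k"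
    "((k + 1) mod 3 + 1) mod 3 = (k + 2) mod 3" "((k + 2) mod 3 + 2) mod 3 = (k + 1) mod 3"
  using less_3_cases[OF assms] by (elim disjE; simp)+

lemma bs_op_same_level:
  "i \<noteq> j \<Longrightarrow> bs_op n (Some (i, k)) (Some (j, k)) = Some (mid n i j, (k + 1) mod 3)"
  by simp

lemma bs_op_up:
  assumes "k < 3" shows "bs_op n (Some (i, k)) (Some (j, (k + 1) mod 3)) = up n i j k"
  using less_3_cases[OF assms] by (elim disjE) simp_all

lemma bs_op_down:
  assumes "k < 3" shows "bs_op n (Some (i, (k + 1) mod 3)) (Some (j, k)) = up n j i k"
  using less_3_cases[OF assms] by (elim disjE) simp_all

lemma bs_op_inf_inf:
  assumes "i < n" "k < 3" "even n"
  shows "bs_op n None (bs_op n None (Some (i, k))) = Some (i, k)"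
proof (cases "mid n i i = i")
  case True
  then have "mid n (i + n div 2) (i + n div 2) = i" "n div 2 \<noteq> 0"
    using mid_lift[OF assms(1) _ assms(3)] assms(3) by auto
  then show ?thesis using True mod_3_shift[OF assms(2)] by simp
next
  case False
  note d = mid_drop[OF assms(1) False]
  show ?thesis using False mod_3_shift[OF assms(2)] by (simp add: d(2,3))
qed

lemma bs_op_Some_inf:
  assumes "i < n" "k < 3" "even n"
  shows "bs_op n (Some (i, k)) (bs_op n (Some (i, k)) None) = None"
proof (cases "mid n i i = i")
  case True
  then have *: "mid n (i + n div 2) (i + n div 2) = i" "n div 2 \<noteq> 0"
    using mid_lift[OF assms(1) _ assms(3)] assms(3) by auto
  \<comment> \<open>The partner of a fixed index sits one level below \<open>k\<close>, cyclically
    level \<open>k + 2\<close>, so the product is read downwards.\<close>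
  have "(k + 2) mod 3 < 3" by simp
  from bs_op_down[OF this, of n i "i + n div 2", unfolded mod_3_shift[OF assms(2)]] show ?thesis
    using True * by (simp add: up_def del: bs_op.simps(4))
next
  case False
  then show ?thesis using bs_op_up[OF assms(2), of n i "mid n i i"]
    by (simp add: up_def del: bs_op.simps(4))
qed

text \<open>The cases are the three kinds of blocks with points on consecutive levels: two points on
  level \<open>k\<close>, a vertical block, a block through \<open>None\<close>.\<close>

lemma bs_op_Some_up:
  assumes "i < n" "j < n" "k < 3"
  shows "bs_op n (Some (i, k)) (up n i j k) = Some (j, (k + 1) mod 3)"
proof -
  consider "j \<noteq> mid n i i" | "mid n i i = j" "j = i" | "mid n i i = j" "j \<noteq> i" by blast
  then show ?thesis
  proof cases
    case 1
    then show ?thesis using bs_op_same_level[of i "quot n i j" n k] quot_ne[of i n j] quot[of i n j] assms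
      by (simp add: up_def del: bs_op.simps)
  next
    case 2
    then have "up n i i l = Some (i, (l + 2) mod 3)" for l by (simp add: up_def)
    with bs_op_down[of "(k + 2) mod 3" n i i] 2 show ?thesis
      by (simp only: mod_3_shift[OF assms(3)] mod_less_divisor zero_less_numeral)
  next
    case 3
    then show ?thesis by (auto simp: up_def)
  qed
qed

lemma bs_op_Some_down:
  assumes "i < n" "j < n" "k < 3"
  shows "bs_op n (Some (i, (k + 1) mod 3)) (up n j i k) = Some (j, k)"
proof -
  consider "i \<noteq> mid n j j" | "mid n j j = i" "j = i" | "mid n j j = i" "j \<noteq> i" by blast
  then show ?thesis
  proof cases
    case 1
    then show ?thesis
      using bs_op_down[OF assms(3), of n i "quot n j i"] quot_quot[OF assms(1,2)]
      by (auto simp add: up_def simp del: bs_op.simps)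
  next
    case 2
    then have "mid n i i = i" by simp
    then have "up n i i l = Some (i, (l + 2) mod 3)" for l by (simp add: up_def)
    with bs_op_up[of "(k + 1) mod 3" n i i] 2(2) show ?thesis
      by (simp only: mod_3_shift[OF assms(3)] mod_less_divisor zero_less_numeral)
  next
    case 3
    \<comment> \<open>The block passes through \<open>None\<close>; as \<open>i\<close> is the
      lowered index of \<open>j\<close>, \<open>inf_op\<close> leads back up to
      \<open>j\<close>.\<close>
    then have "mid n j j \<noteq> j" by auto
    note d = mid_drop[OF assms(2) this]
    have "mid n i i = i" "i + n div 2 = j" using d 3 by auto
    then have "inf_op n (i, (k + 1) mod 3) = Some (j, k)"
      using mod_3_shift(4)[OF assms(3)] by simp
    moreover have "up n j i k = None" using 3 by (auto simp: up_def)
    ultimately show ?thesis by simp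
  qed
qed

text \<open>Two levels modulo 3 are equal or consecutive in one of the two orders.\<close>

lemma bs_op_Some_Some:
  assumes "i < n" "j < n" "k < 3" "l < 3"
  shows "bs_op n (Some (i, k)) (bs_op n (Some (i, k)) (Some (j, l))) = Some (j, l)"
proof -
  have "l = k \<or> l = (k + 1) mod 3 \<or> k = (l + 1) mod 3"
    using less_3_cases[OF assms(3)] less_3_cases[OF assms(4)] by (elim disjE) simp_all
  then consider "l = k" "i = j" | "l = k" "i \<noteq> j" | "l = (k + 1) mod 3" | "k = (l + 1) mod 3"
    by blast
  then show ?thesis
  proof cases
    case 1
    then show ?thesis by simp
  next
    case 2
    have "mid n i j \<noteq> mid n i i" using mid_cancel assms 2 by blast
    then have "up n i (mid n i j) k = Some (j, k)" using quot_mid assms by (simp add: up_def)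
    then show ?thesis using 2 bs_op_same_level bs_op_up[OF assms(3)] by metis
  next
    case 3
    then show ?thesis using bs_op_up bs_op_Some_up assms by metis
  next
    case 4
    then show ?thesis using bs_op_down bs_op_Some_down assms by metis
  qed
qed

lemma steiner_op_bs: "steiner_op (bs_points n) (bs_op n)"
proof -
  have "bs_op n x (bs_op n x y) = y" if "x \<in> bs_points n" "y \<in> bs_points n" for x y
    using that(1)
  proof (cases rule: bs_points_cases)
    case x: 1
    from that(2) show ?thesis
      by (cases rule: bs_points_cases) (use x bs_op_inf_inf in simp_all)
  next
    case x: (2 i k)
    from that(2) show ?thesis
      by (cases rule: bs_points_cases)
         (use x bs_op_Some_inf bs_op_Some_Some in \<open>simp_all del: bs_op.simps\<close>)
  qed
  moreover have "bs_op n x x = x" for x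
    by (cases "(n, x, x)" rule: bs_op.cases) auto
  ultimately show ?thesis
    unfolding steiner_op_def using bs_op_closed bs_op_commute by blast
qed

lemma card_bs_points: "card (bs_points n) = 3 * n + (if even n then 1 else 0)"
  by (subst bs_points_def, subst card_Un_disjoint)
     (auto simp: card_image card_cartesian_product)

lemma ex_steiner_op:
  fixes u :: nat
  assumes "u mod 6 = 1 \<or> u mod 6 = 3"
  shows "\<exists>f. steiner_op {..<u} f"
proof -
  \<comment> \<open>For \<open>u\<close> congruent to 3 modulo 6 this is odd and
    \<open>u = 3 * n\<close>; for 1 it is even and \<open>None\<close> supplies the missing
    point.\<close>
  define n where "n = u div 3"
  have "3 * n + (if even n then 1 else 0) = u"
    using assms unfolding n_def by presburger
  then have "card (bs_points n) = card {..<u}"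
    by (simp add: card_bs_points)
  moreover have "finite (bs_points n)" by (simp add: bs_points_def)
  ultimately obtain h where "bij_betw h (bs_points n) {..<u}"
    using finite_same_card_bij finite_lessThan by blast
  then show ?thesis using steiner_op_transfer steiner_op_bs by blast
qed

section \<open>Distributing the triples over the classes\<close>

locale steiner_quasigroup =
  fixes u :: nat and f :: "nat \<Rightarrow> nat \<Rightarrow> nat"  (infixl "\<star>" 70)
  assumes steiner_op: "steiner_op {..<u} f"
begin

lemma closed: "a < u \<Longrightarrow> b < u \<Longrightarrow> a \<star> b < u"
  and commute: "a < u \<Longrightarrow> b < u \<Longrightarrow> a \<star> b = b \<star> a"
  and cancel: "a < u \<Longrightarrow> b < u \<Longrightarrow> a \<star> (a \<star> b) = b"
  and idem: "a < u \<Longrightarrow> a \<star> a = a"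
  using steiner_op unfolding steiner_op_def by blast+

lemma star_eq_iff: "a < u \<Longrightarrow> b < u \<Longrightarrow> c < u \<Longrightarrow> a \<star> b = c \<longleftrightarrow> b = a \<star> c"
  using cancel by metis

end

text \<open>
  For distinct groups, \<open>lead x y z\<close> says that the group of \<open>x\<close> is the one whose rank among the three
  groups is \<open>(x + y + z) mod 3\<close>; by \<open>lead_cases\<close> each such triple has exactly one leader.
\<close>

definition lead :: "nat \<Rightarrow> nat \<Rightarrow> nat \<Rightarrow> bool" where
  "lead x y z \<longleftrightarrow>
     (x + y + z) mod 3 = of_bool (y div 3 < x div 3) + of_bool (z div 3 < x div 3)"

lemma lead_commute: "lead x y z \<longleftrightarrow> lead x z y"
  by (simp add: lead_def ac_simps)

text \<open>The ranks of three distinct numbers are 0, 1 and 2 in some order, so \<open>s\<close> is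
  the rank of exactly one of them.\<close>

lemma rank_cases:
  fixes a b c s :: nat
  defines "p \<equiv> s = of_bool (b < a) + of_bool (c < a)"
    and "q \<equiv> s = of_bool (a < b) + of_bool (c < b)"
    and "r \<equiv> s = of_bool (a < c) + of_bool (b < c)"
  assumes "s < 3" "a \<noteq> b" "a \<noteq> c" "b \<noteq> c"
  shows "p \<and> \<not> q \<and> \<not> r \<or> \<not> p \<and> q \<and> \<not> r \<or> \<not> p \<and> \<not> q \<and> r"
proof -
  have "a < b \<or> b < a" "a < c \<or> c < a" "b < c \<or> c < b" using assms by auto
  moreover have "s = 0 \<or> s = 1 \<or> s = 2" using \<open>s < 3\<close> by auto
  ultimately show ?thesis unfolding p_def q_def r_def
    by (elim disjE) simp_all
qed

lemma lead_cases:
  assumes "x div 3 \<noteq> y div 3" "x div 3 \<noteq> z div 3" "y div 3 \<noteq> z div 3"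
  obtains "lead x y z" "\<not> lead y x z" "\<not> lead z x y"
    | "\<not> lead x y z" "lead y x z" "\<not> lead z x y"
    | "\<not> lead x y z" "\<not> lead y x z" "lead z x y"
proof -
  define s where "s = (x + y + z) mod 3"
  have s: "(y + x + z) mod 3 = s" "(z + x + y) mod 3 = s" "(x + y + z) mod 3 = s"
    by (simp_all add: s_def ac_simps)
  have "s < 3" by (simp add: s_def)
  from rank_cases[OF this assms] show ?thesis
    using that unfolding lead_def s by blast
qed

lemma group_eq: "{z. z div 3 = c} = {3 * c, 3 * c + 1, 3 * c + (2::nat)}"
  by auto

text \<open>A group is a complete residue system modulo 3, and \<open>2 * s\<close> stands for
  \<open>- s\<close>.\<close>

lemma residue_in_group:
  assumes "k < (3::nat)"
  shows "z div 3 = c \<and> (s + z) mod 3 = k \<longleftrightarrow> z = 3 * c + (k + 2 * s) mod 3"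
proof
  assume *: "z div 3 = c \<and> (s + z) mod 3 = k"
  then have "(k + 2 * s) mod 3 = (s + z + 2 * s) mod 3" by (metis mod_add_left_eq)
  also have "\<dots> = (z + 3 * s) mod 3" by (simp add: algebra_simps)
  also have "\<dots> = z mod 3" by simp
  finally show "z = 3 * c + (k + 2 * s) mod 3" using * by (metis mult_div_mod_eq)
next
  assume *: "z = 3 * c + (k + 2 * s) mod 3"
  then have "(s + z) mod 3 = (s + (3 * c + (k + 2 * s))) mod 3"
    by (simp only: * add.assoc[symmetric] mod_add_right_eq)
  also have "\<dots> = (k + 3 * (c + s)) mod 3" by (simp add: algebra_simps)
  also have "\<dots> = k" using assms by (simp only: mod_mult_self2 mod_less)
  finally show "z div 3 = c \<and> (s + z) mod 3 = k" using * by simp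
qed

text \<open>With the group \<open>c\<close> of \<open>z\<close> fixed, the rank of \<open>x\<close>
  is a constant, so \<open>lead\<close> merely prescribes the residue of \<open>z\<close>.\<close>

lemma lead_first:
  obtains z where "{z. z div 3 = c \<and> lead x y z} = {z}"
proof -
  define k :: nat where "k = of_bool (y div 3 < x div 3) + of_bool (c < x div 3)"
  have "k < 3" by (simp add: k_def)
  have "{z. z div 3 = c \<and> lead x y z} = {z. z div 3 = c \<and> (x + y + z) mod 3 = k}"
    by (rule Collect_cong) (auto simp: lead_def k_def)
  then show ?thesis unfolding residue_in_group[OF \<open>k < 3\<close>] using that by simp
qed

text \<open>As in \<open>lead_first\<close>: the rank of \<open>z\<close> depends only on its
  group.\<close>

lemma lead_third:
  obtains z where "{z. z div 3 = c \<and> lead z x y} = {z}"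
proof -
  define k :: nat where "k = of_bool (x div 3 < c) + of_bool (y div 3 < c)"
  have "k < 3" by (simp add: k_def)
  have "z + x + y = x + y + z" for z by simp
  then have "{z. z div 3 = c \<and> lead z x y} = {z. z div 3 = c \<and> (x + y + z) mod 3 = k}"
    by (intro Collect_cong) (auto simp only: lead_def k_def)
  then show ?thesis unfolding residue_in_group[OF \<open>k < 3\<close>] using that by simp
qed

section \<open>The class of a triple\<close>

context steiner_quasigroup
begin

definition fin_class :: "nat \<Rightarrow> nat \<Rightarrow> nat \<Rightarrow> nat" where
  "fin_class x y z =
     (let a = x div 3; b = y div 3; c = z div 3
      in if a = b then c else if a = c then b else if b = c then a
         else if lead x y z then a \<star> (b \<star> c)
         else if lead y x z then b \<star> (a \<star> c)
         else c \<star> (a \<star> b))"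

text \<open>The infinite points are \<open>3 * u\<close> and \<open>3 * u + 1\<close>. Three
  infinite arguments cannot be distinct; their value is a default.\<close>

definition cls :: "nat \<Rightarrow> nat \<Rightarrow> nat \<Rightarrow> nat" where
  "cls x y z =
     (if x < 3 * u then
        if y < 3 * u then if z < 3 * u then fin_class x y z else (x div 3) \<star> (y div 3)
        else if z < 3 * u then (x div 3) \<star> (z div 3) else x div 3
      else if y < 3 * u then if z < 3 * u then (y div 3) \<star> (z div 3) else y div 3
      else z div 3)"

abbreviation points :: "nat set" where "points \<equiv> {..<3 * u + 2}"

lemma group_less: "x < 3 * u \<Longrightarrow> x div 3 < u"
  by auto

lemma fin_class_swap:
  assumes "x < 3 * u" "y < 3 * u" "z < 3 * u"
  shows "fin_class x y z = fin_class y x z" "fin_class x y z = fin_class x z y"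
proof -
  have *: "lead x z y = lead x y z" "lead y z x = lead y x z" "lead z y x = lead z x y"
    using lead_commute by blast+
  note comm = commute[OF group_less[OF assms(1)] group_less[OF assms(2)]]
    commute[OF group_less[OF assms(1)] group_less[OF assms(3)]]
    commute[OF group_less[OF assms(2)] group_less[OF assms(3)]]
  have "fin_class x y z = fin_class y x z \<and> fin_class x y z = fin_class x z y"
  proof (cases "x div 3 = y div 3 \<or> x div 3 = z div 3 \<or> y div 3 = z div 3")
    case True
    then show ?thesis by (auto simp: fin_class_def Let_def)
  next
    case False
    then have d: "x div 3 \<noteq> y div 3" "x div 3 \<noteq> z div 3" "y div 3 \<noteq> z div 3" by auto
    show ?thesis
      by (cases rule: lead_cases[OF d]) (use d in \<open>simp_all add: fin_class_def * comm Let_def\<close>)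
  qed
  then show "fin_class x y z = fin_class y x z" "fin_class x y z = fin_class x z y" by blast+
qed

lemma cls_swap:
  assumes "x \<in> points" "y \<in> points" "z \<in> points"
  shows "cls x y z = cls y x z" "cls x y z = cls x z y"
proof -
  \<comment> \<open>In the default case of three infinite arguments, \<open>cls\<close> is
    \<open>u\<close> in every order.\<close>
  have inf: "w div 3 = u" if "w \<in> points" "\<not> w < 3 * u" for w
    using that by auto
  show "cls x y z = cls y x z"
    using inf[OF assms(1)] inf[OF assms(2)] commute group_less fin_class_swap(1)
    by (auto simp: cls_def)
  show "cls x y z = cls x z y"
    using inf[OF assms(2)] inf[OF assms(3)] commute group_less fin_class_swap(2)
    by (auto simp: cls_def)
qed

text \<open>Multiplication by a fixed element is an involution, so each of the three equations in
  \<open>fin_class\<close> can be solved for the group of \<open>z\<close>.\<close>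

lemma fin_class_iff:
  assumes "x < 3 * u" "y < 3 * u" "z < 3 * u" "r < u"
    and "x div 3 \<noteq> y div 3" "x div 3 \<noteq> z div 3" "y div 3 \<noteq> z div 3"
  shows "fin_class x y z = r \<longleftrightarrow>
    lead x y z \<and> z div 3 = (y div 3) \<star> ((x div 3) \<star> r) \<or>
    lead y x z \<and> z div 3 = (x div 3) \<star> ((y div 3) \<star> r) \<or>
    lead z x y \<and> z div 3 = ((x div 3) \<star> (y div 3)) \<star> r"
proof -
  note l = group_less[OF assms(1)] group_less[OF assms(2)] group_less[OF assms(3)]
  have "(x div 3) \<star> ((y div 3) \<star> (z div 3)) = r \<longleftrightarrow> z div 3 = (y div 3) \<star> ((x div 3) \<star> r)"
    "(y div 3) \<star> ((x div 3) \<star> (z div 3)) = r \<longleftrightarrow> z div 3 = (x div 3) \<star> ((y div 3) \<star> r)"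
    using l assms(4) by (simp_all add: star_eq_iff closed)
  moreover have "(z div 3) \<star> ((x div 3) \<star> (y div 3)) = r \<longleftrightarrow> z div 3 = ((x div 3) \<star> (y div 3)) \<star> r"
    using star_eq_iff[OF closed[OF l(1,2)] l(3) assms(4)] commute[OF l(3) closed[OF l(1,2)]] by simp
  ultimately show ?thesis
    by (cases rule: lead_cases[OF assms(5-7)]) (use assms(5-7) in \<open>simp_all add: fin_class_def Let_def\<close>)
qed

section \<open>Counting the third points of a pair in a class\<close>

definition thirds :: "nat \<Rightarrow> nat \<Rightarrow> nat \<Rightarrow> nat set" where
  "thirds x y r = {z \<in> points - {x, y}. cls x y z = r}"

lemma thirds_commute: "x \<in> points \<Longrightarrow> y \<in> points \<Longrightarrow> thirds x y r = thirds y x r"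
  unfolding thirds_def using cls_swap(1) by blast

lemma thirds_inf_inf:
  assumes "x \<in> points" "y \<in> points" "\<not> x < 3 * u" "\<not> y < 3 * u" "x \<noteq> y" "r < u"
  shows "thirds x y r = {z. z div 3 = r}"
proof -
  have "z < 3 * u" "z \<noteq> x" "z \<noteq> y" if "z div 3 = r" for z
  proof -
    show "z < 3 * u" using that assms(6) by auto
    then show "z \<noteq> x" "z \<noteq> y" using assms(3,4) by auto
  qed
  then show ?thesis using assms(3,4) by (fastforce simp: thirds_def cls_def)
qed

lemma group_points:
  assumes "c < u" "z div 3 = c"
  shows "z < 3 * u"
  using assms by auto

text \<open>In the class of its own group, \<open>x\<close> gets the other infinite point
  \<open>y'\<close> and the rest of the group; in another class, the whole group
  \<open>(x div 3) \<star> r\<close>.\<close>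

lemma thirds_inf:
  assumes "x < 3 * u" "y \<in> points" "\<not> y < 3 * u" "r < u"
  shows "card (thirds x y r) = 3"
proof -
  have a: "x div 3 < u" using assms(1) by auto
  have "y = 3 * u \<or> y = 3 * u + 1" using assms by auto
  then obtain y' where y': "{y, y'} = {3 * u, 3 * u + 1}" "y \<noteq> y'" by fastforce
  then have "y' \<in> {3 * u, 3 * u + 1}" by blast
  then have y'_inf: "y' \<in> points" "\<not> y' < 3 * u" and "y' \<noteq> x" using assms(1) by auto
  have only: "z = y'" if "z \<in> points" "z \<noteq> y" "\<not> z < 3 * u" for z
  proof -
    have "z \<in> {3 * u, 3 * u + 1}" using that by auto
    with y'(1) that(2) show ?thesis by blast
  qed
  show ?thesis
  proof (cases "r = x div 3")
    case True
    have "cls x y z = r \<longleftrightarrow> z div 3 = x div 3 \<or> z = y'" if "z \<in> points" "z \<noteq> y" for z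
    proof (cases "z < 3 * u")
      case z: True
      then have "z \<noteq> y'" using y'_inf(2) by auto
      moreover have "(x div 3) \<star> (z div 3) = x div 3 \<longleftrightarrow> z div 3 = x div 3"
        using star_eq_iff[OF a group_less[OF z] a] idem[OF a] by simp
      ultimately show ?thesis using z True assms by (simp add: cls_def)
    next
      case False
      then show ?thesis using only[OF that] True assms by (simp add: cls_def)
    qed
    moreover have "z \<in> points \<and> z \<noteq> y" if "z div 3 = x div 3" for z
      using group_points[OF a that] assms(3) by auto
    ultimately have "thirds x y r = insert y' ({z. z div 3 = x div 3} - {x})"
      using y'(2) y'_inf(1) \<open>y' \<noteq> x\<close> by (auto simp: thirds_def)
    moreover have "y' \<notin> {z. z div 3 = x div 3}" using y'_inf(2) a by auto
    moreover have "card ({z. z div 3 = x div 3} - {x}) = 2"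
      by (subst card_Diff_singleton) (auto simp: group_eq)
    ultimately show ?thesis by (simp add: group_eq)
  next
    case False
    have "cls x y z = r \<longleftrightarrow> z div 3 = (x div 3) \<star> r" if "z \<in> points" "z \<noteq> y" for z
    proof (cases "z < 3 * u")
      case True
      then show ?thesis using assms a group_less[OF True] by (simp add: cls_def star_eq_iff)
    next
      case z: False
      then have "z div 3 = u" using that by auto
      then show ?thesis using z False assms a closed[OF a assms(4)] by (simp add: cls_def)
    qed
    moreover have "(x div 3) \<star> r \<noteq> x div 3" using False a assms(4) by (simp add: star_eq_iff idem)
    moreover have "z \<in> points \<and> z \<noteq> y" if "z div 3 = (x div 3) \<star> r" for z
      using group_points[OF closed[OF a assms(4)] that] assms(3) by auto
    ultimately have "thirds x y r = {z. z div 3 = (x div 3) \<star> r}"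
      by (auto simp: thirds_def)
    then show ?thesis by (simp add: group_eq)
  qed
qed

text \<open>In the class of the common group, the third points are the two infinite points and the
  last point of the group; in another class, the group \<open>r\<close>.\<close>

lemma thirds_same_group:
  assumes "x < 3 * u" "y < 3 * u" "x \<noteq> y" "x div 3 = y div 3" "r < u"
  shows "card (thirds x y r) = 3"
proof -
  have a: "x div 3 < u" using assms(1) by auto
  have fin: "cls x y z = z div 3" if "z < 3 * u" for z
    using that assms by (simp add: cls_def fin_class_def)
  have inf: "cls x y z = x div 3" if "\<not> z < 3 * u" for z
    using that assms idem[OF a] by (simp add: cls_def)
  show ?thesis
  proof (cases "r = x div 3")
    case True
    have "thirds x y r = {3 * u, 3 * u + 1} \<union> ({z. z div 3 = x div 3} - {x, y})"
      using True assms a fin inf by (auto simp: thirds_def)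
    moreover have "{3 * u, 3 * u + 1} \<inter> ({z. z div 3 = x div 3} - {x, y}) = {}"
      using a by auto
    moreover have "card ({z. z div 3 = x div 3} - {x, y}) = 1"
      using assms by (subst card_Diff_subset) (auto simp: group_eq)
    ultimately show ?thesis by (simp add: card_Un_disjoint group_eq)
  next
    case False
    have "cls x y z = r \<longleftrightarrow> z div 3 = r" if "z \<in> points" for z
    proof (cases "z < 3 * u")
      case z: False
      then have "z div 3 = u" using that by auto
      with inf[OF z] False assms(5) show ?thesis by simp
    qed (simp add: fin)
    moreover have "z \<in> points - {x, y}" if "z div 3 = r" for z
      using that False assms by auto
    ultimately have "thirds x y r = {z. z div 3 = r}"
      by (auto simp: thirds_def)
    then show ?thesis by (simp add: group_eq)
  qed
qed


lemma cls_fin: "x < 3 * u \<Longrightarrow> y < 3 * u \<Longrightarrow> z < 3 * u \<Longrightarrow> cls x y z = fin_class x y z"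
  and cls_inf: "x < 3 * u \<Longrightarrow> y < 3 * u \<Longrightarrow> \<not> z < 3 * u \<Longrightarrow> cls x y z = (x div 3) \<star> (y div 3)"
  by (simp_all add: cls_def)

text \<open>Two third points are the other points of the group \<open>b\<close> of \<open>y\<close>.
  Among triples with distinct groups, leader \<open>x\<close> yields one point \<open>w\<close> in
  group \<open>a \<star> b\<close>; the other two leaders would force \<open>z\<close> into group
  \<open>b\<close>.\<close>

lemma thirds_first_group:
  assumes "x < 3 * u" "y < 3 * u" "x div 3 \<noteq> y div 3"
  shows "card (thirds x y (x div 3)) = 3"
proof -
  define a b where ab: "a = x div 3" "b = y div 3"
  have a: "a < u" "b < u" "a \<noteq> b" using assms by (auto simp: ab)
  note ac = closed[OF a(1,2)] and comm = commute[OF a(1,2)]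
  have ne: "a \<star> b \<noteq> a" "a \<star> b \<noteq> b"
    using star_eq_iff[OF a(1,2,1)] star_eq_iff[OF a(2,1,2)] idem a comm by auto
  obtain w where w: "{z. z div 3 = a \<star> b \<and> lead x y z} = {w}" by (rule lead_first)
  have "cls x y z = a \<longleftrightarrow> z div 3 = b \<or> z = w" if "z \<in> points" "z \<noteq> x" "z \<noteq> y" for z
  proof (cases "z < 3 * u")
    case z: True
    show ?thesis
    proof (cases "z div 3 = a \<or> z div 3 = b")
      case True
      then have "cls x y z = (if z div 3 = a then b else a)"
        using cls_fin[OF assms(1,2) z] a(3) by (auto simp: fin_class_def Let_def ab)
      moreover have "z \<noteq> w" using True ne w by auto
      ultimately show ?thesis using True a(3) by auto
    next
      case False
      have "b \<star> (a \<star> a) = a \<star> b" "a \<star> (b \<star> a) = b" "(a \<star> b) \<star> a = b"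
        using idem[OF a(1)] cancel[OF a(1,2)] comm commute[OF a(1) ac] by metis+
      with False have "cls x y z = a \<longleftrightarrow> lead x y z \<and> z div 3 = a \<star> b"
        using fin_class_iff[OF assms(1,2) z a(1)[unfolded ab] assms(3), folded ab] cls_fin[OF assms(1,2) z]
        by metis
      then show ?thesis using False w z by blast
    qed
  next
    case z: False
    then have "z div 3 \<noteq> b" "z \<noteq> w"
      using that group_points[OF a(2)] group_points[OF ac] w by blast+
    then show ?thesis using cls_inf[OF assms(1,2) z] ne by (simp add: ab)
  qed
  moreover have "z \<in> points \<and> z \<noteq> x" if "z div 3 = b" for z
    using group_points[OF a(2) that] that a(3) by (auto simp: ab)
  moreover have "w div 3 = a \<star> b" using w by blast
  then have w': "w < 3 * u" "w \<in> points" "w div 3 \<noteq> a" "w div 3 \<noteq> b"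
    using group_points[OF ac, of w] ne by simp_all
  then have "w \<noteq> x" "w \<noteq> y" by (auto simp: ab)
  ultimately have "thirds x y a = insert w ({z. z div 3 = b} - {y})"
    using w' by (auto simp: thirds_def)
  moreover have "card ({z. z div 3 = b} - {y}) = 2"
    by (subst card_Diff_singleton) (auto simp: group_eq ab)
  moreover have "w \<notin> {z. z div 3 = b} - {y}" using w' by simp
  moreover have "finite ({z. z div 3 = b} - {y})" by (simp add: group_eq)
  ultimately show ?thesis by (simp flip: ab)
qed

text \<open>Both infinite points qualify. Leader \<open>z\<close> adds one point in group
  \<open>a \<star> b\<close>; the other two leaders would force \<open>z\<close> into a group
  already present.\<close>

lemma thirds_product:
  assumes "x < 3 * u" "y < 3 * u" "x div 3 \<noteq> y div 3"
  shows "card (thirds x y ((x div 3) \<star> (y div 3))) = 3"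
proof -
  define a b where ab: "a = x div 3" "b = y div 3"
  have a: "a < u" "b < u" "a \<noteq> b" using assms by (auto simp: ab)
  note ac = closed[OF a(1,2)] and comm = commute[OF a(1,2)]
  have ne: "a \<star> b \<noteq> a" "a \<star> b \<noteq> b"
    using star_eq_iff[OF a(1,2,1)] star_eq_iff[OF a(2,1,2)] idem a comm by auto
  obtain w where w: "{z. z div 3 = a \<star> b \<and> lead z x y} = {w}" by (rule lead_third)
  have "cls x y z = a \<star> b \<longleftrightarrow> z = w \<or> \<not> z < 3 * u" if "z \<in> points" for z
  proof (cases "z < 3 * u")
    case z: True
    show ?thesis
    proof (cases "z div 3 = a \<or> z div 3 = b")
      case True
      then have "cls x y z = (if z div 3 = a then b else a)"
        using cls_fin[OF assms(1,2) z] a(3) by (auto simp: fin_class_def Let_def ab)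
      then have "cls x y z \<noteq> a \<star> b" using ne by simp
      moreover have "z \<noteq> w" using True ne w by auto
      ultimately show ?thesis using z by blast
    next
      case False
      have "b \<star> (a \<star> (a \<star> b)) = b" "a \<star> (b \<star> (a \<star> b)) = a" "(a \<star> b) \<star> (a \<star> b) = a \<star> b"
        using idem[OF ac] cancel[OF a(1,2)] cancel[OF a(2,1)] idem[OF a(1)] idem[OF a(2)] comm by metis+
      with False have "cls x y z = a \<star> b \<longleftrightarrow> lead z x y \<and> z div 3 = a \<star> b"
        using fin_class_iff[OF assms(1,2) z ac[unfolded ab] assms(3), folded ab] cls_fin[OF assms(1,2) z]
        by metis
      then show ?thesis using w z by blast
    qed
  next
    case z: False
    then show ?thesis using cls_inf[OF assms(1,2) z] by (simp add: ab)
  qed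
  moreover have "w div 3 = a \<star> b" using w by blast
  then have w': "w < 3 * u" "w div 3 \<noteq> a" "w div 3 \<noteq> b"
    using group_points[OF ac, of w] ne by simp_all
  then have "w \<noteq> x" "w \<noteq> y" by (auto simp: ab)
  ultimately have "thirds x y (a \<star> b) = {w, 3 * u, 3 * u + 1}"
    using w'(1) assms(1,2) by (auto simp: thirds_def)
  then show ?thesis using w'(1) by (simp flip: ab)
qed

text \<open>Each of the three leaders determines a third group and, in it, one point; no other kind
  of triple contributes.\<close>

lemma thirds_generic:
  assumes "x < 3 * u" "y < 3 * u" "x div 3 \<noteq> y div 3" "r < u"
    and "r \<noteq> x div 3" "r \<noteq> y div 3" "r \<noteq> (x div 3) \<star> (y div 3)"
  shows "card (thirds x y r) = 3"
proof -
  define a b where ab: "a = x div 3" "b = y div 3"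
  have a: "a < u" "b < u" "a \<noteq> b" and r: "r \<noteq> a" "r \<noteq> b" "r \<noteq> a \<star> b"
    using assms by (auto simp: ab)
  define c1 c2 c3 where c: "c1 = b \<star> (a \<star> r)" "c2 = a \<star> (b \<star> r)" "c3 = (a \<star> b) \<star> r"
  note cl = closed[OF a(1,2)] closed[OF a(1) assms(4)] closed[OF a(2) assms(4)]
  have c_less: "c1 < u" "c2 < u" "c3 < u" using closed a assms(4) by (auto simp: c)
  \<comment> \<open>Any coincidence would force \<open>r\<close> to be \<open>a\<close>,
    \<open>b\<close> or \<open>a \<star> b\<close>.\<close>
  have "c1 \<noteq> a" "c1 \<noteq> b" "c2 \<noteq> a" "c2 \<noteq> b" "c3 \<noteq> a" "c3 \<noteq> b"
    unfolding c using a r assms(4) cl cancel idem commute by metis+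
  note ne = this
  obtain z1 where z1: "{z. z div 3 = c1 \<and> lead x y z} = {z1}" by (rule lead_first)
  obtain z2 where z2: "{z. z div 3 = c2 \<and> lead y x z} = {z2}" by (rule lead_first)
  obtain z3 where z3: "{z. z div 3 = c3 \<and> lead z x y} = {z3}" by (rule lead_third)
  have zi: "z1 div 3 = c1" "lead x y z1" "z2 div 3 = c2" "lead y x z2" "z3 div 3 = c3" "lead z3 x y"
    using z1 z2 z3 by blast+
  have z_less: "z1 < 3 * u" "z2 < 3 * u" "z3 < 3 * u"
    using zi group_points c_less by blast+
  have "cls x y z = r \<longleftrightarrow> z \<in> {z1, z2, z3}" if "z \<in> points" for z
  proof (cases "z < 3 * u")
    case z: True
    have zs: "z = z1 \<longleftrightarrow> z div 3 = c1 \<and> lead x y z" "z = z2 \<longleftrightarrow> z div 3 = c2 \<and> lead y x z"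
      "z = z3 \<longleftrightarrow> z div 3 = c3 \<and> lead z x y"
      using z1 z2 z3 by blast+
    show ?thesis
    proof (cases "z div 3 = a \<or> z div 3 = b")
      case True
      then have "cls x y z = a \<or> cls x y z = b"
        using cls_fin[OF assms(1,2) z] by (auto simp: fin_class_def Let_def ab)
      then show ?thesis using True ne zi r by auto
    next
      case False
      then have "cls x y z = r \<longleftrightarrow> lead x y z \<and> z div 3 = c1 \<or> lead y x z \<and> z div 3 = c2
          \<or> lead z x y \<and> z div 3 = c3"
        using fin_class_iff[OF assms(1,2) z assms(4,3)] cls_fin[OF assms(1,2) z]
        by (simp add: ab c)
      then show ?thesis using zs by blast
    qed
  next
    case z: False
    then show ?thesis using cls_inf[OF assms(1,2) z] z_less r by (auto simp: ab)
  qed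
  moreover have "x \<notin> {z1, z2, z3}" "y \<notin> {z1, z2, z3}" using zi ne by (auto simp: ab)
  ultimately have "thirds x y r = {z1, z2, z3}"
    using z_less by (auto simp: thirds_def)
  moreover have "z1 \<noteq> z2" "z1 \<noteq> z3" "z2 \<noteq> z3"
  proof -
    \<comment> \<open>The three points differ because their leaders do, even if the groups
      \<open>c1\<close>, \<open>c2\<close>, \<open>c3\<close> coincide.\<close>
    have "\<not> (lead x y z \<and> lead y x z)" "\<not> (lead x y z \<and> lead z x y)" "\<not> (lead y x z \<and> lead z x y)"
      if "z div 3 \<noteq> a" "z div 3 \<noteq> b" for z
      using lead_cases[of x y z] that assms(3) unfolding ab by metis+
    then show "z1 \<noteq> z2" "z1 \<noteq> z3" "z2 \<noteq> z3" using zi ne by metis+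
  qed
  ultimately show ?thesis by simp
qed

text \<open>All positions of the pair and of \<open>r\<close> have been treated; the class
  \<open>y div 3\<close> is the first-group case with the pair exchanged.\<close>

lemma card_thirds:
  assumes "x \<in> points" "y \<in> points" "x \<noteq> y" "r < u"
  shows "card (thirds x y r) = 3"
proof -
  consider "\<not> x < 3 * u" "\<not> y < 3 * u" | "x < 3 * u" "\<not> y < 3 * u" | "\<not> x < 3 * u" "y < 3 * u"
    | "x < 3 * u" "y < 3 * u" by blast
  then show ?thesis
  proof cases
    case 1
    then show ?thesis using thirds_inf_inf assms by (simp add: group_eq)
  next
    case 2
    then show ?thesis using thirds_inf assms by blast
  next
    case 3
    then show ?thesis using thirds_inf[of y x r] thirds_commute[of x y r] assms by simp
  next
    case 4
    then show ?thesis
      using thirds_same_group[OF 4 assms(3) _ assms(4)] thirds_first_group[OF 4]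
        thirds_first_group[OF 4(2,1)] thirds_product[OF 4] thirds_generic[OF 4 _ assms(4)]
        thirds_commute[OF assms(1,2), of r]
      by metis
  qed
qed

section \<open>The two large sets\<close>

lemma fin_class_less: "x < 3 * u \<Longrightarrow> y < 3 * u \<Longrightarrow> z < 3 * u \<Longrightarrow> fin_class x y z < u"
  by (simp add: fin_class_def Let_def closed group_less)

text \<open>Among three distinct points one is finite, so the default value does not occur.\<close>

lemma cls_less:
  assumes "x \<in> points" "y \<in> points" "z \<in> points" "x \<noteq> y" "x \<noteq> z" "y \<noteq> z"
  shows "cls x y z < u"
proof (cases "x < 3 * u \<or> y < 3 * u")
  case True
  then show ?thesis by (auto simp only: cls_def fin_class_less closed group_less split: if_split)
next
  case False
  then have "z < 3 * u" using assms by auto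
  then show ?thesis using False by (simp add: cls_def group_less)
qed

section \<open>The triples of a class as blocks\<close>

definition blocks :: "nat \<Rightarrow> nat set set" where
  "blocks r = {{x, y, z} | x y z. x \<in> points \<and> y \<in> points \<and> z \<in> points \<and>
     x \<noteq> y \<and> x \<noteq> z \<and> y \<noteq> z \<and> cls x y z = r}"

lemma cls_permute:
  assumes "x \<in> points" "y \<in> points" "z \<in> points"
  shows "cls x z y = cls x y z" "cls y x z = cls x y z" "cls y z x = cls x y z"
    "cls z x y = cls x y z" "cls z y x = cls x y z"
proof -
  show *: "cls x z y = cls x y z" "cls y x z = cls x y z"
    using cls_swap[OF assms] by simp_all
  show "cls y z x = cls x y z" using cls_swap(2)[OF assms(2,3,1)] *(2) by simp
  show "cls z x y = cls x y z" using cls_swap(1)[OF assms(3,1,2)] *(1) by simp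
  show "cls z y x = cls x y z"
    using cls_swap(1)[OF assms(3,2,1)] cls_swap(2)[OF assms(2,3,1)] *(2) by simp
qed

text \<open>Symmetry of \<open>cls\<close> makes the order in which a block is listed
  irrelevant.\<close>

lemma triple_in_blocks_iff:
  assumes "x \<in> points" "y \<in> points" "z \<in> points" "x \<noteq> y" "x \<noteq> z" "y \<noteq> z"
  shows "{x, y, z} \<in> blocks r \<longleftrightarrow> cls x y z = r"
proof
  assume "{x, y, z} \<in> blocks r"
  then obtain a b c where abc: "{x, y, z} = {a, b, c}" "a \<noteq> b" "a \<noteq> c" "b \<noteq> c" "cls a b c = r"
    unfolding blocks_def by auto
  then have "a \<in> {x, y, z}" "b \<in> {x, y, z}" "c \<in> {x, y, z}" by auto
  then show "cls x y z = r"
    using abc(2-5) cls_permute[OF assms(1-3)] by auto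
next
  assume "cls x y z = r"
  then show "{x, y, z} \<in> blocks r" using assms unfolding blocks_def by blast
qed

lemma blocksD:
  assumes "B \<in> blocks r" shows "B \<subseteq> points" "card B = 3"
  using assms by (auto simp: blocks_def)

lemma finite_blocks: "finite (blocks r)"
  by (rule finite_subset[of _ "Pow points"]) (use blocksD in auto)

lemma ex1_blocks:
  assumes "T \<subseteq> points" "card T = 3"
  shows "\<exists>!r. r < u \<and> T \<in> blocks r"
proof -
  obtain x y z where "T = {x, y, z}" "x \<noteq> y" "x \<noteq> z" "y \<noteq> z"
    using assms(2) by (auto simp: card_3_iff)
  then show ?thesis using assms(1) triple_in_blocks_iff[of x y z] cls_less[of x y z] by auto
qed

lemma blocks_above_pair:
  assumes "x \<in> points" "y \<in> points" "x \<noteq> y"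
  shows "{B \<in> blocks r. {x, y} \<subseteq> B} = (\<lambda>z. {x, y, z}) ` thirds x y r"
proof (intro equalityI subsetI)
  fix B assume "B \<in> {B \<in> blocks r. {x, y} \<subseteq> B}"
  then have B: "B \<in> blocks r" "x \<in> B" "y \<in> B" by auto
  have "card (B - {x, y}) = 1"
    using B blocksD[OF B(1)] assms(3) by (subst card_Diff_subset) auto
  then obtain z where z: "B - {x, y} = {z}" by (auto simp: card_1_singleton_iff)
  then have Beq: "B = {x, y, z}" "z \<noteq> x" "z \<noteq> y" using B by auto
  then have "z \<in> points" using blocksD(1)[OF B(1)] by auto
  then have "z \<in> thirds x y r"
    using triple_in_blocks_iff[OF assms(1,2) _ assms(3)] Beq B(1) by (auto simp: thirds_def)
  then show "B \<in> (\<lambda>z. {x, y, z}) ` thirds x y r" using Beq by blast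
next
  fix B assume "B \<in> (\<lambda>z. {x, y, z}) ` thirds x y r"
  then obtain z where "B = {x, y, z}" "z \<in> points" "z \<noteq> x" "z \<noteq> y" "cls x y z = r"
    by (auto simp: thirds_def)
  then show "B \<in> {B \<in> blocks r. {x, y} \<subseteq> B}"
    using triple_in_blocks_iff[OF assms(1,2) _ assms(3), of z] by auto
qed

lemma card_blocks_above_pair:
  assumes "P \<subseteq> points" "card P = 2" "r < u"
  shows "card {B \<in> blocks r. P \<subseteq> B} = 3"
proof -
  obtain x y where P: "P = {x, y}" "x \<noteq> y" using assms(2) by (auto simp: card_2_iff)
  then have xy: "x \<in> points" "y \<in> points" using assms(1) by auto
  have "inj_on (\<lambda>z. {x, y, z}) (thirds x y r)"
    by (rule inj_onI) (auto simp: thirds_def insert_eq_iff)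
  then show ?thesis
    unfolding P(1) blocks_above_pair[OF xy P(2)]
    using card_thirds[OF xy P(2) assms(3)] by (simp add: card_image)
qed

section \<open>The five-point sets\<close>

definition five :: "nat \<Rightarrow> nat set" where
  "five r = {z. z div 3 = r} \<union> {3 * u, 3 * u + 1}"

lemma five_subset: "r < u \<Longrightarrow> five r \<subseteq> points"
  using group_points by (auto simp: five_def)

lemma card_five: "r < u \<Longrightarrow> card (five r) = 5"
  by (auto simp: five_def group_eq)

text \<open>All finite points involved have group \<open>r\<close> and at least one of the three is
  finite, so idempotence gives \<open>r\<close> for every kind of triple.\<close>

lemma cls_five:
  assumes "r < u" "x \<in> five r" "y \<in> five r" "z \<in> five r" "x \<noteq> y" "x \<noteq> z" "y \<noteq> z"
  shows "cls x y z = r"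
proof -
  have "w \<in> {3 * u, 3 * u + 1} \<or> w < 3 * u \<and> w div 3 = r" if "w \<in> five r" for w
    using that group_points[OF assms(1), of w] by (simp add: five_def) blast
  note * = this[OF assms(2)] this[OF assms(3)] this[OF assms(4)]
  then have fin: "x < 3 * u \<Longrightarrow> x div 3 = r" "y < 3 * u \<Longrightarrow> y div 3 = r" "z < 3 * u \<Longrightarrow> z div 3 = r"
    by auto
  moreover have "x < 3 * u \<or> y < 3 * u \<or> z < 3 * u" using * assms(5-7) by blast
  ultimately show ?thesis using idem[OF assms(1)]
    by (cases "x < 3 * u"; cases "y < 3 * u"; cases "z < 3 * u") (simp_all add: cls_def fin_class_def)
qed

lemma triple_five_in_blocks:
  assumes "r < u" "T \<subseteq> five r" "card T = 3"
  shows "T \<in> blocks r"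
proof -
  obtain x y z where T: "T = {x, y, z}" and ne: "x \<noteq> y" "x \<noteq> z" "y \<noteq> z"
    using assms(3) by (auto simp: card_3_iff)
  then have five: "x \<in> five r" "y \<in> five r" "z \<in> five r" using assms(2) by blast+
  then have "x \<in> points" "y \<in> points" "z \<in> points" using five_subset[OF assms(1)] by blast+
  from triple_in_blocks_iff[OF this ne] cls_five[OF assms(1) five ne] T show ?thesis by blast
qed

text \<open>The three triples inside \<open>five r\<close> above \<open>P\<close> already exhaust
  the three blocks above \<open>P\<close>. Hence the triples inside \<open>five r\<close> can be
  exchanged for copies of \<open>five r\<close>.\<close>

lemma blocks_above_pair_in_five:
  assumes "r < u" "P \<subseteq> five r" "card P = 2" "B \<in> blocks r" "P \<subseteq> B"
  shows "B \<subseteq> five r"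
proof -
  have finP: "finite P" by (rule card_ge_0_finite) (simp add: assms(3))
  have "card (five r - P) = 3"
    using card_Diff_subset[OF finP assms(2)] card_five[OF assms(1)] assms(3) by simp
  moreover have "inj_on (\<lambda>z. insert z P) (five r - P)"
    by (rule inj_onI) blast
  ultimately have "card ((\<lambda>z. insert z P) ` (five r - P)) = 3" by (simp add: card_image)
  moreover have "(\<lambda>z. insert z P) ` (five r - P) \<subseteq> {B \<in> blocks r. P \<subseteq> B}"
  proof (rule image_subsetI)
    fix z assume z: "z \<in> five r - P"
    then have "insert z P \<subseteq> five r" "card (insert z P) = 3" using assms(2,3) finP by simp_all
    then show "insert z P \<in> {B \<in> blocks r. P \<subseteq> B}"
      using triple_five_in_blocks[OF assms(1)] by blast
  qed
  moreover have "card {B \<in> blocks r. P \<subseteq> B} = 3"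
    using assms(2) five_subset[OF assms(1)] by (intro card_blocks_above_pair assms(1,3)) blast
  ultimately have "(\<lambda>z. insert z P) ` (five r - P) = {B \<in> blocks r. P \<subseteq> B}"
    using finite_blocks by (intro card_subset_eq) auto
  moreover have "B \<in> {B \<in> blocks r. P \<subseteq> B}" using assms(4,5) by simp
  ultimately have "B \<in> (\<lambda>z. insert z P) ` (five r - P)" by (simp only:)
  then obtain z where "z \<in> five r - P" "B = insert z P" by (rule imageE)
  then show ?thesis using assms(2) by simp
qed

lemma five_inter: "r \<noteq> s \<Longrightarrow> five r \<inter> five s = {3 * u, 3 * u + 1}"
  unfolding five_def by blast

section \<open>The two families of block multisets\<close>

definition simple_blocks :: "nat \<Rightarrow> nat set multiset" where
  "simple_blocks r = mset_set (blocks r)"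

text \<open>Multiplicity 3 makes up for the removed triples above each pair of
  \<open>five r\<close>, and it equals both \<open>card (five r) - 2\<close> and the index that LS*
  demands.\<close>

definition star_blocks :: "nat \<Rightarrow> nat set multiset" where
  "star_blocks r = mset_set {B \<in> blocks r. \<not> B \<subseteq> five r} + replicate_mset 3 (five r)"

lemma in_simple_blocks: "B \<in># simple_blocks r \<longleftrightarrow> B \<in> blocks r"
  by (simp add: simple_blocks_def finite_blocks)

lemma in_star_blocks: "B \<in># star_blocks r \<longleftrightarrow> B \<in> blocks r \<and> \<not> B \<subseteq> five r \<or> B = five r"
  by (simp add: star_blocks_def finite_blocks) blast

lemma pair_design_simple:
  assumes "r < u"
  shows "pair_design 3 {3} (3 * u + 2) points (simple_blocks r)"
  unfolding pair_design_def
proof (intro conjI allI impI ballI)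
  fix P :: "nat set" assume P: "P \<subseteq> points \<and> card P = 2"
  then show "size {#B \<in># simple_blocks r. P \<subseteq> B#} = 3"
    using card_blocks_above_pair[of P r] assms
    by (simp add: simple_blocks_def finite_blocks filter_mset_mset_set)
next
  fix B assume "B \<in># simple_blocks r"
  then have "B \<in> blocks r" by (simp add: in_simple_blocks)
  then show "B \<subseteq> points" "card B \<in> {3}" using blocksD[of B r] by simp_all
qed simp_all

lemma pair_design_star:
  assumes "r < u"
  shows "pair_design 3 {3, 5} (3 * u + 2) points (star_blocks r)"
  unfolding pair_design_def
proof (intro conjI allI impI ballI)
  fix P :: "nat set" assume P: "P \<subseteq> points \<and> card P = 2"
  let ?A = "{B \<in> blocks r. \<not> B \<subseteq> five r}"
  have size: "size {#B \<in># star_blocks r. P \<subseteq> B#} = card {B \<in> ?A. P \<subseteq> B} + (if P \<subseteq> five r then 3 else 0)"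
    by (simp add: star_blocks_def finite_blocks filter_mset_mset_set numeral_3_eq_3)
  show "size {#B \<in># star_blocks r. P \<subseteq> B#} = 3"
  proof (cases "P \<subseteq> five r")
    case True
    \<comment> \<open>Every triple above \<open>P\<close> has been removed, so only the copies of
      \<open>five r\<close> count.\<close>
    then have "{B \<in> ?A. P \<subseteq> B} = {}"
      using blocks_above_pair_in_five assms P by blast
    then show ?thesis using True by (simp only: size) simp
  next
    case False
    then have "{B \<in> ?A. P \<subseteq> B} = {B \<in> blocks r. P \<subseteq> B}" by blast
    then show ?thesis using False card_blocks_above_pair[of P r] assms P by (simp only: size) simp
  qed
next
  fix B assume "B \<in># star_blocks r"
  then have "B \<in> blocks r \<or> B = five r" by (auto simp only: in_star_blocks)
  then show "B \<subseteq> points" "card B \<in> {3, 5}"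
    using blocksD[of B r] five_subset[OF assms] card_five[OF assms] by blast+
qed simp_all

lemma large_set_simple: "large_set 3 {3} (3 * u + 2) points {..<u} simple_blocks"
  unfolding large_set_def
proof (intro conjI ballI)
  have "\<exists>!B. B \<in> (\<Union>r<u. blocks r) \<and> T \<subseteq> B" if T: "T \<subseteq> points" "card T = 3" for T
  proof (rule ex1I)
    show "T \<in> (\<Union>r<u. blocks r) \<and> T \<subseteq> T" using ex1_blocks[OF T] by auto
    fix B assume B: "B \<in> (\<Union>r<u. blocks r) \<and> T \<subseteq> B"
    then have "card B = 3" "finite B" using blocksD by (auto intro: finite_subset)
    then show "B = T" using B T(2) card_subset_eq[of B T] by auto
  qed
  moreover have "B \<subseteq> points \<and> card B \<in> {3}" if "B \<in> (\<Union>r<u. blocks r)" for B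
    using that blocksD by blast
  ultimately show "triple_design {3} (3 * u + 2) points (\<Union>r<u. set_mset (simple_blocks r))"
    by (simp add: triple_design_def simple_blocks_def finite_blocks)
next
  fix B assume "B \<in> (\<Union>r<u. set_mset (simple_blocks r))"
  then obtain r where r: "r < u" "B \<in> blocks r" by (auto simp: in_simple_blocks)
  have "B \<in> blocks s \<longleftrightarrow> s = r" if "s < u" for s
    using ex1_blocks[OF blocksD[OF r(2)]] r that by blast
  then have "count (\<Sum>r<u. simple_blocks r) B = (\<Sum>s<u. if s = r then 1 else 0)"
    unfolding count_sum
    by (intro sum.cong) (simp_all add: simple_blocks_def finite_blocks count_mset_set')
  also have "\<dots> = card B - 2" using r(1) blocksD(2)[OF r(2)] by simp
  finally show "count (\<Sum>r<u. simple_blocks r) B = card B - 2" .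
qed (use pair_design_simple in simp_all)

lemma large_set_star: "large_set_star 3 {3, 5} (3 * u + 2) points {..<u} star_blocks"
  unfolding large_set_star_def large_set_def
proof (intro conjI ballI impI)
  let ?U = "\<Union>r<u. set_mset (star_blocks r)"
  have "\<exists>!B. B \<in> ?U \<and> T \<subseteq> B" if T: "T \<subseteq> points" "card T = 3" for T
  proof -
    obtain r where r: "r < u" "T \<in> blocks r" using ex1_blocks[OF T] by blast
    have unique: "s = r" if "s < u" "T \<in> blocks s" for s using ex1_blocks[OF T] r that by blast
    have five: "s = r" if "s < u" "T \<subseteq> five s" for s
      using unique that triple_five_in_blocks T(2) by blast
    have triple: "B = T" if "B \<in> blocks s" "T \<subseteq> B" for B s
      using that blocksD[OF that(1)] T(2) card_subset_eq[of B T] by (auto intro: finite_subset)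
    \<comment> \<open>The block containing \<open>T\<close> is \<open>five r\<close> if
      \<open>T\<close> lies inside it, and \<open>T\<close> itself otherwise.\<close>
    show ?thesis
    proof (cases "T \<subseteq> five r")
      case True
      show ?thesis
      proof (rule ex1I[of _ "five r"])
        show "five r \<in> ?U \<and> T \<subseteq> five r" using True r(1) in_star_blocks by blast
        fix B assume "B \<in> ?U \<and> T \<subseteq> B"
        then obtain s where s: "s < u" "B \<in># star_blocks s" "T \<subseteq> B" by blast
        then consider "B \<in> blocks s" "\<not> B \<subseteq> five s" | "B = five s" using in_star_blocks by blast
        then show "B = five r"
        proof cases
          case 1
          then have "B = T" using triple s(3) by blast
          with 1 unique s(1) True show ?thesis by blast
        next
          case 2
          with five s show ?thesis by blast
        qed
      qed
    next
      case False
      show ?thesis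
      proof (rule ex1I[of _ T])
        show "T \<in> ?U \<and> T \<subseteq> T" using False r in_star_blocks by blast
        fix B assume "B \<in> ?U \<and> T \<subseteq> B"
        then obtain s where "s < u" "B \<in># star_blocks s" "T \<subseteq> B" by blast
        then show "B = T" using False five triple in_star_blocks by blast
      qed
    qed
  qed
  moreover have "B \<subseteq> points \<and> card B \<in> {3, 5}" if "B \<in> ?U" for B
  proof -
    obtain r where "r < u" "B \<in> blocks r \<or> B = five r" using \<open>B \<in> ?U\<close> in_star_blocks by blast
    then show ?thesis using blocksD[of B r] five_subset[of r] card_five[of r] by blast
  qed
  ultimately show "triple_design {3, 5} (3 * u + 2) points ?U"
    by (simp add: triple_design_def)
next
  fix B assume "B \<in> (\<Union>r<u. set_mset (star_blocks r))"
  then obtain r where r: "r < u" "B \<in># star_blocks r" by auto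
  have ne: "B \<noteq> five s" if "B \<in> blocks t" "s < u" for s t
    using that card_five[OF that(2)] blocksD(2)[OF that(1)] by auto
  show "count (\<Sum>r<u. star_blocks r) B = card B - 2"
  proof (cases "B = five r")
    case True
    have "five r = five s \<longleftrightarrow> s = r" if "s < u" for s
    proof
      assume eq: "five r = five s"
      show "s = r"
      \<comment> \<open>Distinct five-sets share only the two infinite points.\<close>
      proof (rule ccontr)
        assume "s \<noteq> r"
        then have "five s = {3 * u, 3 * u + 1}" using five_inter[of s r] eq by simp
        then show False using card_five[OF that] by simp
      qed
    qed simp
    moreover have "B \<notin> blocks s" for s using ne True r(1) by blast
    ultimately have "count (\<Sum>r<u. star_blocks r) B = (\<Sum>s<u. if s = r then 3 else 0)"
      unfolding count_sum True
      by (intro sum.cong) (simp_all add: star_blocks_def count_mset_set')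
    also have "\<dots> = card B - 2" using r(1) card_five[OF r(1)] by (simp add: True)
    finally show ?thesis .
  next
    case False
    then have B: "B \<in> blocks r" "\<not> B \<subseteq> five r" using r by (auto simp: in_star_blocks)
    have "B \<in> blocks s \<longleftrightarrow> s = r" if "s < u" for s
      using ex1_blocks[OF blocksD[OF B(1)]] r(1) B(1) that by blast
    then have "count (\<Sum>r<u. star_blocks r) B = (\<Sum>s<u. if s = r then 1 else 0)"
      unfolding count_sum
      by (intro sum.cong) (use ne[OF B(1)] B r(1) in \<open>auto simp: star_blocks_def finite_blocks count_mset_set'\<close>)
    also have "\<dots> = card B - 2" using r(1) blocksD(2)[OF B(1)] by simp
    finally show ?thesis .
  qed
next
  fix r B assume "r \<in> {..<u}" "B \<in># star_blocks r" "4 \<le> card B"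
  then have "B \<notin> blocks r" "B = five r" using blocksD(2)[of B r] in_star_blocks by auto
  then show "count (star_blocks r) B = 3" by (simp add: star_blocks_def count_mset_set')
qed (use pair_design_star in simp_all)

end

section \<open>Eulerian digraphs on the links of the infinite points\<close>

lemma eulerian_digraph_symmetric:
  assumes "finite S" "A \<subseteq> S \<times> S" "\<And>x y. (x, y) \<in> A \<Longrightarrow> (y, x) \<in> A \<and> x \<noteq> y"
  shows "eulerian_digraph \<lparr>pverts = S, parcs = A\<rparr>"
proof -
  have "finite A" using assms(1,2) finite_subset by blast
  then have "pair_digraph \<lparr>pverts = S, parcs = A\<rparr>"
    by unfold_locales (use assms in auto)
  moreover have "card {e \<in> A. snd e = x} = card {e \<in> A. fst e = x}" for x
  proof (rule bij_betw_same_card)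
    \<comment> \<open>Reversal exchanges the arcs into \<open>x\<close> with those out of
      \<open>x\<close>.\<close>
    show "bij_betw prod.swap {e \<in> A. snd e = x} {e \<in> A. fst e = x}"
      by (rule bij_betw_byWitness[where f' = prod.swap]) (use assms(3) in auto)
  qed
  ultimately show ?thesis
    by (simp add: eulerian_digraph_def in_degree_def out_degree_def in_arcs_def out_arcs_def)
qed

context steiner_quasigroup
begin

text \<open>\<open>cls\<close> treats both infinite points alike, so they have a common link. For
  \<open>x = y\<close> the set is too small to be a block.\<close>

lemma link_simple:
  assumes "x < 3 * u" "y < 3 * u" "i \<in> {3 * u, 3 * u + 1}"
  shows "{i, x, y} \<in># simple_blocks r \<longleftrightarrow> x \<noteq> y \<and> (x div 3) \<star> (y div 3) = r"
proof (cases "x = y")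
  case True
  then have "card {i, x, y} \<noteq> 3" using card_insert_le_m1[of 2 "{y}" i] by simp
  then show ?thesis using True blocksD(2)[of "{i, x, y}" r] by (auto simp only: in_simple_blocks)
next
  case False
  have i: "i \<in> points" "\<not> i < 3 * u" using assms(3) by auto
  have "{i, x, y} \<in> blocks r \<longleftrightarrow> cls i x y = r"
    using triple_in_blocks_iff[of i x y r] i assms(1,2) False by auto
  then show ?thesis using False assms(1,2) i(2) by (simp add: in_simple_blocks cls_def)
qed

text \<open>By idempotence, a pair within one group has product \<open>r\<close> exactly if that
  group is \<open>r\<close>; these are the pairs whose triples are absorbed by
  \<open>five r\<close>.\<close>

lemma link_star:
  assumes "x < 3 * u" "y < 3 * u" "i \<in> {3 * u, 3 * u + 1}" "r < u"
  shows "{i, x, y} \<in># star_blocks r \<longleftrightarrow> x div 3 \<noteq> y div 3 \<and> (x div 3) \<star> (y div 3) = r"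
proof -
  have "card {i, x, y} \<le> 3" by (simp add: card_insert_if)
  then have "{i, x, y} \<noteq> five r" using card_five[OF assms(4)] by auto
  moreover have "{i, x, y} \<subseteq> five r \<longleftrightarrow> x div 3 = r \<and> y div 3 = r"
    using assms(1-3) by (simp add: five_def) blast
  moreover have "(x div 3) \<star> (x div 3) = x div 3" using idem group_less assms(1) by blast
  ultimately show ?thesis
    using link_simple[OF assms(1-3), of r] idem[OF assms(4)]
    unfolding in_star_blocks in_simple_blocks by metis
qed

definition simple_digraph :: "nat \<Rightarrow> nat pair_pre_digraph" where
  "simple_digraph r = \<lparr>pverts = {..<3 * u},
     parcs = {(x, y). x < 3 * u \<and> y < 3 * u \<and> x \<noteq> y \<and> (x div 3) \<star> (y div 3) = r}\<rparr>"

definition star_digraph :: "nat \<Rightarrow> nat pair_pre_digraph" where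
  "star_digraph r = \<lparr>pverts = {..<3 * u},
     parcs = {(x, y). x < 3 * u \<and> y < 3 * u \<and> x div 3 \<noteq> y div 3 \<and> (x div 3) \<star> (y div 3) = r}\<rparr>"

lemma eulerian_simple_digraph: "eulerian_digraph (simple_digraph r)"
  unfolding simple_digraph_def
  by (rule eulerian_digraph_symmetric) (auto simp: commute group_less)

lemma eulerian_star_digraph: "eulerian_digraph (star_digraph r)"
  unfolding star_digraph_def
  by (rule eulerian_digraph_symmetric) (auto simp: commute group_less)

lemma points_eq: "{..<3 * u} \<union> {3 * u, 3 * u + 1} = points"
  by auto

lemma pointed_design_simple:
  assumes "r < u"
  shows "pointed_design 3 {3} {3} {3} (3 * u + 2) {..<3 * u} (3 * u) (3 * u + 1) (simple_blocks r)"
  unfolding pointed_design_def points_eq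
  using pair_design_simple[OF assms] blocksD(2)[of _ r] by (simp add: in_simple_blocks)

text \<open>The infinite points form a pair of \<open>five r\<close>, so every triple of the class
  containing both lies in \<open>five r\<close> and has been replaced.\<close>

lemma pointed_design_star:
  assumes "r < u"
  shows "pointed_design 3 {3} {3} {5} (3 * u + 2) {..<3 * u} (3 * u) (3 * u + 1) (star_blocks r)"
proof -
  let ?I = "{3 * u, 3 * u + 1}"
  have "(card (B \<inter> ?I) = 0 \<longrightarrow> card B \<in> {3}) \<and> (card (B \<inter> ?I) = 1 \<longrightarrow> card B \<in> {3}) \<and>
      (card (B \<inter> ?I) = 2 \<longrightarrow> card B \<in> {5})" if "B \<in># star_blocks r" for B
  proof (cases "B = five r")
    case True
    then have "B \<inter> ?I = ?I" by (auto simp: five_def)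
    then show ?thesis using True card_five[OF assms] by simp
  next
    case False
    then have B: "B \<in> blocks r" "\<not> B \<subseteq> five r" using that in_star_blocks by blast+
    have I: "?I \<subseteq> five r" "card ?I = 2" by (simp_all add: five_def)
    have "\<not> ?I \<subseteq> B" using blocks_above_pair_in_five[OF assms I B(1)] B(2) by blast
    then have "B \<inter> ?I \<subset> ?I" by blast
    then have "card (B \<inter> ?I) < card ?I" by (intro psubset_card_mono) simp
    then have "card (B \<inter> ?I) \<noteq> 2" using I(2) by linarith
    then show ?thesis using blocksD(2)[OF B(1)] by simp
  qed
  moreover have "{3} \<union> {3} \<union> {5} = {3, 5::nat}" by auto
  ultimately show ?thesis
    unfolding pointed_design_def points_eq using pair_design_star[OF assms] by simp
qed

section \<open>Assembling the good large sets\<close>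

lemma good_large_set_simple:
  "good_large_set 3 {3} {3} (3 * u + 2) {..<3 * u} (3 * u) (3 * u + 1) {..<u} simple_blocks simple_digraph"
  unfolding good_large_set_def
proof (intro conjI ballI impI)
  fix r assume "r \<in> {..<u}"
  then have "r < u" by simp
  have "(x, y) \<in> parcs (simple_digraph r) \<longleftrightarrow>
      x \<in> {..<3 * u} \<and> y \<in> {..<3 * u} \<and> (\<exists>i\<in>{3 * u, 3 * u + 1}. {i, x, y} \<in># simple_blocks r)" for x y
    using link_simple[of x y _ r] by (auto simp only: simple_digraph_def pair_pre_digraph.simps)
  then have "underlying_edges (simple_digraph r) =
     {{x, y} | x y. x \<in> {..<3 * u} \<and> y \<in> {..<3 * u} \<and> (\<exists>i\<in>{3 * u, 3 * u + 1}. {i, x, y} \<in># simple_blocks r)}"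
    unfolding underlying_edges_def by (simp only:)
  then show "good_design 3 {3} {3} (3 * u + 2) {..<3 * u} (3 * u) (3 * u + 1) (simple_blocks r) (simple_digraph r)"
    unfolding good_design_def
    using pointed_design_simple[OF \<open>r < u\<close>] eulerian_simple_digraph
    by (simp add: simple_digraph_def)
next
  show "pointed_large_set 3 {3} {3} {3} (3 * u + 2) {..<3 * u} (3 * u) (3 * u + 1) {..<u} simple_blocks"
    unfolding pointed_large_set_def points_eq
    using pointed_design_simple large_set_simple by simp
next
  fix x y assume "x \<in> {..<3 * u}" "y \<in> {..<3 * u}"
    and "x \<noteq> y \<and> \<not> (\<exists>B\<in>\<Union>r<u. set_mset (simple_blocks r). {3 * u, 3 * u + 1} \<subset> B \<and> {x, y} \<subseteq> B)"
  then have xy: "x < 3 * u" "y < 3 * u" "x \<noteq> y" by auto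
  \<comment> \<open>The product of the two groups is the one class whose digraph has the
    arc.\<close>
  then have "(x div 3) \<star> (y div 3) < u" by (intro closed group_less)
  with xy show "\<exists>!r. r \<in> {..<u} \<and> (x, y) \<in> parcs (simple_digraph r)"
    by (auto simp: simple_digraph_def)
qed

lemma pointed_large_set_star:
  "pointed_large_set_star 3 {3} {3} {5} (3 * u + 2) {..<3 * u} (3 * u) (3 * u + 1) {..<u} star_blocks"
proof -
  have "{3} \<union> {3} \<union> {5} = {3, 5::nat}" by auto
  then show ?thesis
    unfolding pointed_large_set_star_def points_eq
    using pointed_design_star large_set_star by simp
qed

lemma good_large_set_star:
  "good_large_set_star 3 {3} {5} (3 * u + 2) {..<3 * u} (3 * u) (3 * u + 1) {..<u} star_blocks star_digraph"
  unfolding good_large_set_star_def good_large_set_def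
proof (intro conjI ballI impI)
  fix r assume "r \<in> {..<u}"
  then have "r < u" by simp
  have "(x, y) \<in> parcs (star_digraph r) \<longleftrightarrow>
      x \<in> {..<3 * u} \<and> y \<in> {..<3 * u} \<and> (\<exists>i\<in>{3 * u, 3 * u + 1}. {i, x, y} \<in># star_blocks r)" for x y
    using link_star[of x y _ r] \<open>r < u\<close> by (auto simp only: star_digraph_def pair_pre_digraph.simps)
  then have "underlying_edges (star_digraph r) =
     {{x, y} | x y. x \<in> {..<3 * u} \<and> y \<in> {..<3 * u} \<and> (\<exists>i\<in>{3 * u, 3 * u + 1}. {i, x, y} \<in># star_blocks r)}"
    unfolding underlying_edges_def by (simp only:)
  then show "good_design 3 {3} {5} (3 * u + 2) {..<3 * u} (3 * u) (3 * u + 1) (star_blocks r) (star_digraph r)"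
    unfolding good_design_def
    using pointed_design_star[OF \<open>r < u\<close>] eulerian_star_digraph
    by (simp add: star_digraph_def)
next
  show "pointed_large_set 3 {3} {3} {5} (3 * u + 2) {..<3 * u} (3 * u) (3 * u + 1) {..<u} star_blocks"
    using pointed_large_set_star
    unfolding pointed_large_set_star_def pointed_large_set_def large_set_star_def by blast
next
  fix x y assume *: "x \<in> {..<3 * u}" "y \<in> {..<3 * u}"
    and **: "x \<noteq> y \<and> \<not> (\<exists>B\<in>\<Union>r<u. set_mset (star_blocks r). {3 * u, 3 * u + 1} \<subset> B \<and> {x, y} \<subseteq> B)"
  from * have xy: "x < 3 * u" "y < 3 * u" by auto
  \<comment> \<open>A pair within one group lies in a five-set, a block through both infinite
    points, and is exempt.\<close>
  have "x div 3 \<noteq> y div 3"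
  proof
    assume eq: "x div 3 = y div 3"
    let ?B = "five (x div 3)"
    have "?B \<in> (\<Union>r<u. set_mset (star_blocks r))"
      using group_less[OF xy(1)] in_star_blocks by blast
    moreover have "x \<in> ?B" "y \<in> ?B" "{3 * u, 3 * u + 1} \<subseteq> ?B" using eq by (simp_all add: five_def)
    moreover have "x \<notin> {3 * u, 3 * u + 1}" using xy(1) by simp
    ultimately show False using ** by blast
  qed
  moreover have "(x div 3) \<star> (y div 3) < u" using xy by (intro closed group_less)
  ultimately show "\<exists>!r. r \<in> {..<u} \<and> (x, y) \<in> parcs (star_digraph r)"
    using xy by (auto simp: star_digraph_def)
qed (rule pointed_large_set_star)

end

theorem theorem3p8:
  fixes u :: nat
  assumes "u > 0" and "u mod 6 = 1 \<or> u mod 6 = 3"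
  shows "(\<exists>(S :: nat set) inf1 inf2 (R :: nat set) \<B> D.
            good_large_set_star 3 {3} {5} (3 * u + 2) S inf1 inf2 R \<B> D) \<and>
         (\<exists>(S :: nat set) inf1 inf2 (R :: nat set) \<B> D.
            good_large_set 3 {3} {3} (3 * u + 2) S inf1 inf2 R \<B> D)"
proof -
  obtain f where "steiner_op {..<u} f" using ex_steiner_op[OF assms(2)] by blast
  then interpret steiner_quasigroup u f by unfold_locales
  show ?thesis using good_large_set_star good_large_set_simple by blast
qed

end
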